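(* Let $C\ge 1$ be a constant and let $A(1),A(2),\ldots$ be a sequence of non-negative integers satisfying, for all $n>C$, a linear recurrence $$A(n)=\sum_{i=1}^{C} D(n,i)\,A(n-i)$$ whose coefficients $D(n,i)$ are non-negative integers, of $\mathrm{poly}(n)$ size (that is, bounded by a polynomial in $n$), and such that $(1^n\,0\,1^i)\mapsto D(n,i)$ is in $\mathsf{FL}_{\ge0}$. Then the function $(1^n)\mapsto A(n)$ is in $\#\mathsf{L}$. Here $A(1),\ldots,A(C)$ are given constants.
   Context: The alphabet is $\Sigma=\{0,1\}$; $1^a$ is the string of $a$ ones and juxtaposition is concatenation. A function given only on strings of a displayed form is extended by $0$ to all other strings. $\#\mathsf{L}$ is the class of functions $f:\Sigma^*\to\mathbb{N}_0$ such that $f(x)$ is the number of accepting computation paths on input $x$ of a fixed nondeterministic Turing machine with read-only input tape that uses $O(\log|x|)$ work space and halts on every computation path. Equivalently: there are a polynomial $q$ and a deterministic $O(\log|x|)$-space Turing machine $M$ with an additional read-once, left-to-right witness tape such that $f(x)=\#\{w\in\Sigma^{q(|x|)}\mid M(x,w)=\mathsf{yes}\}$. $\mathsf{FL}_{\ge0}$ is the class of functions $\Sigma^*\to\mathbb{N}_0$ computable (output in binary) by a deterministic log-space Turing machine with read-only input tape and write-only output tape (not counted as space). *)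

theory Defs
  imports
    Complex_Main
    "HOL-Library.Landau_Symbols"
    "HOL-Computational_Algebra.Polynomial"
begin

section \<open>Strings\<close>

text \<open>The alphabet \<open>{0,1}\<close> is \<^typ>\<open>bool\<close>: \<open>1\<close> is \<^const>\<open>True\<close> and \<open>0\<close> is \<^const>\<open>False\<close>.\<close>

definition ones :: "nat \<Rightarrow> bool list" where
  "ones a = replicate a True"

text \<open>
  \<open>extend0 enc I g\<close> is the function given by \<open>enc i \<mapsto> g i\<close> for \<open>i \<in> I\<close> and extended by \<open>0\<close>
  to all other strings; it is meaningful for \<open>enc\<close> injective on \<open>I\<close>.
\<close>

definition extend0 :: "('i \<Rightarrow> bool list) \<Rightarrow> 'i set \<Rightarrow> ('i \<Rightarrow> nat) \<Rightarrow> bool list \<Rightarrow> nat" where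
  "extend0 enc I g x = (if x \<in> enc ` I then g (inv_into I enc x) else 0)"


section \<open>Turing machines with a read-only input tape\<close>

datatype move = Go_Left | Stay | Go_Right

datatype input_symbol = Left_End | Sym bool | Right_End

text \<open>
  States and work tape symbols are natural numbers, \<open>0\<close> being the blank.  An instruction is
  one tuple of the transition relation: in state \<open>cur\<close>, reading \<open>inp\<close> on the input tape and
  \<open>reads\<close> on the work tapes, the machine may go to state \<open>nxt\<close>, move the input head by
  \<open>imove\<close>, and on each work tape write a symbol and then move the head, as prescribed by \<open>acts\<close>.
  The label \<open>out\<close> has no effect on the computation.  It is trivial (\<^typ>\<open>unit\<close>) for machines
  without output; for transducers it is a \<^typ>\<open>bool option\<close>, the symbol appended to the
  write-only output tape, if any.
\<close>

record 'o instr =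
  cur :: nat
  inp :: input_symbol
  reads :: "nat list"
  nxt :: nat
  imove :: move
  acts :: "(nat \<times> move) list"
  out :: 'o

record 'o machine =
  tapes :: nat
  start :: nat
  accepting :: "nat set"
  instrs :: "'o instr set"

text \<open>
  The state set and the work alphabet are finite because the set of instructions is.
\<close>

definition wf_machine :: "'o machine \<Rightarrow> bool" where
  "wf_machine M \<longleftrightarrow> finite (instrs M) \<and>
     (\<forall>i\<in>instrs M. length (reads i) = tapes M \<and> length (acts i) = tapes M)"

definition deterministic :: "'o machine \<Rightarrow> bool" where
  "deterministic M \<longleftrightarrow> (\<forall>i\<in>instrs M. \<forall>j\<in>instrs M.
     cur i = cur j \<and> inp i = inp j \<and> reads i = reads j \<longrightarrow> i = j)"

text \<open>
  Work tapes are infinite to the right; each is given by its head position and its contents.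
\<close>

record config =
  state :: nat
  ipos :: nat
  work :: "(nat \<times> (nat \<Rightarrow> nat)) list"

definition init :: "'o machine \<Rightarrow> config" where
  "init M = \<lparr>state = start M, ipos = 0, work = replicate (tapes M) (0, \<lambda>_. 0)\<rparr>"

text \<open>
  The input \<open>x\<close> occupies the cells \<open>1, \<dots>, length x\<close>, between two end markers.
\<close>

definition input_cell :: "bool list \<Rightarrow> nat \<Rightarrow> input_symbol" where
  "input_cell x p =
     (if p = 0 then Left_End else if p \<le> length x then Sym (x ! (p - 1)) else Right_End)"

text \<open>A left move on the leftmost cell has no effect.\<close>

fun shift :: "move \<Rightarrow> nat \<Rightarrow> nat" where
  "shift Go_Left p = p - 1"
| "shift Stay p = p"
| "shift Go_Right p = p + 1"

definition applicable :: "'o machine \<Rightarrow> bool list \<Rightarrow> config \<Rightarrow> 'o instr \<Rightarrow> bool" where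
  "applicable M x c i \<longleftrightarrow> i \<in> instrs M \<and> cur i = state c \<and> inp i = input_cell x (ipos c) \<and>
     reads i = map (\<lambda>(p, t). t p) (work c)"

text \<open>
  The input head cannot move past the right end marker; otherwise its position would
  provide storage that is not accounted for.
\<close>

definition exec :: "bool list \<Rightarrow> 'o instr \<Rightarrow> config \<Rightarrow> config" where
  "exec x i c =
     \<lparr>state = nxt i,
      ipos = min (length x + 1) (shift (imove i) (ipos c)),
      work = map2 (\<lambda>(a, d) (p, t). (shift d p, t(p := a))) (acts i) (work c)\<rparr>"

text \<open>
  Computations are identified with the sequences of instructions executed, so that a
  computation path is a sequence of nondeterministic choices.
\<close>

fun run :: "'o machine \<Rightarrow> bool list \<Rightarrow> config \<Rightarrow> 'o instr list \<Rightarrow> config \<Rightarrow> bool" where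
  "run M x c [] c' \<longleftrightarrow> c' = c"
| "run M x c (i # is) c' \<longleftrightarrow> applicable M x c i \<and> run M x (exec x i c) is c'"

definition halted :: "'o machine \<Rightarrow> bool list \<Rightarrow> config \<Rightarrow> bool" where
  "halted M x c \<longleftrightarrow> (\<forall>i. \<not> applicable M x c i)"

definition halts_on_every_path :: "'o machine \<Rightarrow> bool list \<Rightarrow> bool" where
  "halts_on_every_path M x \<longleftrightarrow>
     (\<nexists>\<sigma> :: nat \<Rightarrow> 'o instr. \<forall>m. \<exists>c. run M x (init M) (map \<sigma> [0..<m]) c)"

definition accepting_paths :: "'o machine \<Rightarrow> bool list \<Rightarrow> 'o instr list set" where
  "accepting_paths M x =
     {is. \<exists>c. run M x (init M) is c \<and> halted M x c \<and> state c \<in> accepting M}"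

text \<open>
  The bound \<open>s\<close> applies to each work tape separately; as the number of tapes is constant, this
  does not affect the order of magnitude.
\<close>

definition log_space :: "'o machine \<Rightarrow> bool" where
  "log_space M \<longleftrightarrow> (\<exists>s :: nat \<Rightarrow> nat. (\<lambda>n. real (s n)) \<in> O(\<lambda>n. ln (real n)) \<and>
     (\<forall>x is c. run M x (init M) is c \<longrightarrow> (\<forall>(p, t)\<in>set (work c). p < s (length x))))"


section \<open>The classes \<open>#L\<close> and \<open>FL\<^sub>\<ge>\<^sub>0\<close>\<close>

definition sharpL :: "(bool list \<Rightarrow> nat) set" where
  "sharpL = {f. \<exists>M :: unit machine. wf_machine M \<and> log_space M \<and>
     (\<forall>x. halts_on_every_path M x \<and> f x = card (accepting_paths M x))}"

text \<open>
  The output is read in binary, most significant bit first; the empty output and leading zeros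
  are allowed.  \<^const>\<open>horner_sum\<close> expects the least significant bit first.
\<close>

definition binary_value :: "bool list \<Rightarrow> nat" where
  "binary_value bs = horner_sum of_bool 2 (rev bs)"

definition FL_nonneg :: "(bool list \<Rightarrow> nat) set" where
  "FL_nonneg = {f. \<exists>M :: bool option machine. wf_machine M \<and> deterministic M \<and> log_space M \<and>
     (\<forall>x. \<exists>is c. run M x (init M) is c \<and> halted M x c \<and>
        f x = binary_value (List.map_filter out is))}"


section \<open>Finiteness of the set of accepting paths\<close>

lemma run_append:
  "run M x c (is @ js) c' \<longleftrightarrow> (\<exists>d. run M x c is d \<and> run M x d js c')"
  by (induction "is" arbitrary: c) auto

lemma finite_accepting_paths:
  assumes wf: "wf_machine M" and halts: "halts_on_every_path M x"
  shows "finite (accepting_paths M x)"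
proof (rule ccontr)
  define R where "R is = {js. \<exists>c. run M x (init M) (is @ js) c}" for "is"
  assume "infinite (accepting_paths M x)"
  moreover have "accepting_paths M x \<subseteq> R []"
    by (auto simp: accepting_paths_def R_def)
  ultimately have inf0: "infinite (R [])"
    using finite_subset by blast
  have step: "\<exists>i. infinite (R (is @ [i]))" if "infinite (R is)" for "is"
  proof (rule ccontr)
    assume "\<nexists>i. infinite (R (is @ [i]))"
    moreover have "R is \<subseteq> insert [] (\<Union>i\<in>instrs M. (#) i ` R (is @ [i]))"
    proof
      fix js assume js: "js \<in> R is"
      show "js \<in> insert [] (\<Union>i\<in>instrs M. (#) i ` R (is @ [i]))"
      proof (cases js)
        case (Cons i ks)
        then have "i \<in> instrs M" "ks \<in> R (is @ [i])"
          using js by (auto simp: R_def run_append applicable_def)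
        then show ?thesis using Cons by auto
      qed auto
    qed
    moreover have "finite (instrs M)"
      using wf by (simp add: wf_machine_def)
    ultimately have "finite (R is)"
      by (intro finite_subset[of "R is" "insert [] (\<Union>i\<in>instrs M. (#) i ` R (is @ [i]))"]) auto
    then show False using that by simp
  qed
  then obtain g where g: "\<And>is. infinite (R is) \<Longrightarrow> infinite (R (is @ [g is]))"
    by metis
  define P where "P = rec_nat [] (\<lambda>_ is. is @ [g is])"
  have P: "P 0 = []" "P (Suc m) = P m @ [g (P m)]" for m
    by (simp_all add: P_def)
  have "infinite (R (P m))" for m
    by (induction m) (use inf0 g P in auto)
  then have "R (P m) \<noteq> {}" for m
    by (metis finite.emptyI)
  then have "\<exists>c. run M x (init M) (P m) c" for m
    unfolding R_def run_append by blast
  moreover have "P m = map (\<lambda>k. g (P k)) [0..<m]" for m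
    by (induction m) (auto simp: P)
  ultimately show False
    using halts unfolding halts_on_every_path_def by metis
qed

end

theory Submission
  imports Defs "HOL-Library.Countable" "HOL-Real_Asymp.Real_Asymp"
begin

text \<open>
  By the recurrence, \<open>A n\<close> is the weighted number of ways to descend from \<open>n\<close> to some \<open>m \<le> C\<close> by
  steps of size at most \<open>C\<close>, where a step from \<open>m\<close> to \<open>m - i\<close> has the weight \<open>D m i\<close> and an end
  point \<open>m \<le> C\<close> has the weight \<open>A m\<close>.  A nondeterministic machine produces this number of
  accepting paths by guessing \<open>i\<close> at each step, splitting the path into \<open>D m i\<close> paths, and
  replacing \<open>m\<close> by \<open>m - i\<close>.

  To split, it simulates the transducer for \<open>D\<close> on \<open>1\<^sup>m 0 1\<^sup>i\<close> and guesses, along with the output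
  bits as they appear, the bits of a number smaller than the output: a path is \<^emph>\<open>tight\<close> while
  the two bit strings agree, and \<^emph>\<open>free\<close> once the guess has become smaller.  Since the most
  significant bit comes first, the number of paths that end free is the value of the output
  (\<open>sum_guesses\<close>).  The output itself is never stored.

  The virtual input \<open>1\<^sup>m 0 1\<^sup>i\<close> requires both \<open>m\<close> and a virtual head position.  The real input is
  \<open>1\<^sup>n\<close> with \<open>n \<ge> m\<close>.  While the virtual head is in the block \<open>1\<^sup>m\<close>, the real head is in the
  same position \<open>h\<close>, and a binary counter on a work tape holds \<open>c = m + 1 - h\<close>; the counter
  reaches \<open>0\<close> on the separating \<open>0\<close>, and the bounded excursion beyond it is kept in the state.
  As \<open>h + c = m + 1\<close> throughout, \<open>m\<close> is never lost and no second counter is needed: after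
  the simulation the head moves right until the counter is \<open>0\<close>, and then \<open>i\<close> cells to the left.

  The work tapes of the simulated transducer must be blank again before the next simulation.
  To this end the visited cells are distinguished from the unvisited ones and the leftmost cell
  from the others, so that a sweep to the right and back erases everything.

  \<open>path_count\<close> captures halting, the space bound and the number of accepting paths
  simultaneously, by induction on the computation tree.  The main steps are \<open>count_Sim\<close> (a
  simulation multiplies the number of paths by \<open>D m i\<close>), \<open>count_clear\<close> (return to blank tapes
  and to \<open>m - i\<close>) and \<open>count_recurrence\<close> (\<open>A m\<close> paths from the configuration that represents
  \<open>m\<close>).
\<close>

section \<open>Counting accepting paths\<close>

text \<open>
  \<open>path_count M x s c n\<close>: from the configuration \<open>c\<close>, every path of \<open>M\<close> on input \<open>x\<close> halts,
  keeps all work heads to the left of position \<open>s\<close>, and exactly \<open>n\<close> paths accept.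
\<close>

inductive path_count :: "'o machine \<Rightarrow> bool list \<Rightarrow> nat \<Rightarrow> config \<Rightarrow> nat \<Rightarrow> bool"
  for M :: "'o machine" and x :: "bool list" and s :: nat where
  halt: "halted M x c \<Longrightarrow> \<forall>(p, t)\<in>set (work c). p < s \<Longrightarrow>
    path_count M x s c (of_bool (state c \<in> accepting M))"
| step: "\<not> halted M x c \<Longrightarrow> \<forall>(p, t)\<in>set (work c). p < s \<Longrightarrow>
    (\<And>i. applicable M x c i \<Longrightarrow> path_count M x s (exec x i c) (f i)) \<Longrightarrow>
    path_count M x s c (\<Sum>i | applicable M x c i. f i)"

text \<open>The accepting continuations of \<open>c\<close>, generalizing \<^const>\<open>accepting_paths\<close>.\<close>

definition paths_from :: "'o machine \<Rightarrow> bool list \<Rightarrow> config \<Rightarrow> 'o instr list set" where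
  "paths_from M x c = {is. \<exists>d. run M x c is d \<and> halted M x d \<and> state d \<in> accepting M}"

lemma finite_applicable: "wf_machine M \<Longrightarrow> finite {i. applicable M x c i}"
  by (rule finite_subset[of _ "instrs M"]) (auto simp: applicable_def wf_machine_def)

lemma paths_from_halted:
  assumes "halted M x c"
  shows "paths_from M x c = (if state c \<in> accepting M then {[]} else {})"
proof -
  have "run M x c is d \<longleftrightarrow> is = [] \<and> d = c" for "is" d
    using assms by (cases "is") (auto simp: halted_def)
  then show ?thesis using assms by (auto simp: paths_from_def)
qed

lemma paths_from_step:
  assumes "\<not> halted M x c"
  shows "paths_from M x c = (\<Union>i\<in>{i. applicable M x c i}. (#) i ` paths_from M x (exec x i c))"
    (is "?L = ?R")
proof (rule set_eqI)
  fix "is"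
  show "is \<in> ?L \<longleftrightarrow> is \<in> ?R"
    using assms by (cases "is") (auto simp: paths_from_def)
qed

lemma path_count_card:
  assumes "path_count M x s c n" and wf: "wf_machine M"
  shows "finite (paths_from M x c) \<and> card (paths_from M x c) = n"
  using assms(1)
proof induction
  case (halt c)
  then show ?case by (simp add: paths_from_halted)
next
  case (step c f)
  let ?I = "{i. applicable M x c i}"
  have fin: "finite ?I" using wf by (rule finite_applicable)
  have "card (\<Union>i\<in>?I. (#) i ` paths_from M x (exec x i c)) =
      (\<Sum>i\<in>?I. card ((#) i ` paths_from M x (exec x i c)))"
    using fin step.IH by (intro card_UN_disjoint) auto
  also have "\<dots> = (\<Sum>i\<in>?I. f i)"
    using step.IH by (intro sum.cong) (auto simp: card_image)
  finally show ?case
    using fin step by (auto simp: paths_from_step)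
qed

lemma path_count_halts:
  assumes "path_count M x s c n"
  shows "\<not> (\<forall>m. \<exists>d. run M x c (map \<sigma> [0..<m]) d)"
  using assms
proof (induction arbitrary: \<sigma>)
  case (halt c)
  show ?case
  proof
    assume "\<forall>m. \<exists>d. run M x c (map \<sigma> [0..<m]) d"
    then obtain d where "run M x c (map \<sigma> [0..<1]) d" by blast
    then show False using halt by (simp add: halted_def)
  qed
next
  case (step c f)
  show ?case
  proof
    assume runs: "\<forall>m. \<exists>d. run M x c (map \<sigma> [0..<m]) d"
    have unfold: "map \<sigma> [0..<Suc m] = \<sigma> 0 # map (\<sigma> \<circ> Suc) [0..<m]" for m
      by (subst upt_conv_Cons) (simp_all add: map_Suc_upt[symmetric] del: upt_Suc)
    have *: "applicable M x c (\<sigma> 0) \<and> (\<exists>d. run M x (exec x (\<sigma> 0) c) (map (\<sigma> \<circ> Suc) [0..<m]) d)" for m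
      using runs[rule_format, of "Suc m"] unfolding unfold by auto
    then show False using step.IH by blast
  qed
qed

text \<open>The space bound holds in all reachable configurations, on rejecting paths as well.\<close>

lemma path_count_space:
  assumes "path_count M x s c n" "run M x c is d" "(p, t) \<in> set (work d)"
  shows "p < s"
  using assms
proof (induction arbitrary: "is")
  case (halt c)
  then show ?case by (cases "is") (auto simp: halted_def)
next
  case (step c f)
  then show ?case by (cases "is") auto
qed

lemma sharpL_intro:
  fixes M :: "unit machine"
  assumes wf: "wf_machine M"
    and s: "(\<lambda>n. real (s n)) \<in> O(\<lambda>n. ln (real n))"
    and count: "\<And>x. path_count M x (s (length x)) (init M) (f x)"
  shows "f \<in> sharpL"
proof -
  have "log_space M"
    unfolding log_space_def using s path_count_space[OF count] by blast
  moreover have "halts_on_every_path M x" for x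
    unfolding halts_on_every_path_def using path_count_halts[OF count] by blast
  moreover have "f x = card (accepting_paths M x)" for x
    using path_count_card[OF count wf, of x] by (simp add: paths_from_def accepting_paths_def)
  ultimately show ?thesis
    unfolding sharpL_def using wf by (intro CollectI exI[of _ M]) simp
qed

section \<open>Machines with structured states\<close>

text \<open>
  \<open>act\<close> writes a symbol and moves the head on one tape, as in \<^const>\<open>exec\<close>; \<open>read\<close> yields the
  scanned symbol.
\<close>

abbreviation act :: "nat \<times> move \<Rightarrow> nat \<times> (nat \<Rightarrow> nat) \<Rightarrow> nat \<times> (nat \<Rightarrow> nat)" where
  "act \<equiv> \<lambda>(a, d) (p, t). (shift d p, t(p := a))"

abbreviation read :: "nat \<times> (nat \<Rightarrow> nat) \<Rightarrow> nat" where
  "read \<equiv> \<lambda>(p, t). t p"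

text \<open>
  A machine with \<open>k\<close> work tapes given by a transition function on an arbitrary countable type of
  states.  Only the states in the finite set \<open>Q\<close> and the symbols below \<open>G\<close> give rise to
  instructions; the states in \<open>F\<close> are accepting.
\<close>

locale program =
  fixes k G :: nat and Q F :: "'q :: countable set" and q\<^sub>0 :: 'q
    and delta :: "'q \<Rightarrow> input_symbol \<Rightarrow> nat list \<Rightarrow> ('q \<times> move \<times> (nat \<times> move) list) set"
  assumes finite_Q: "finite Q"
    and finite_delta: "finite (delta q a rs)"
    and length_delta: "(q', d, as) \<in> delta q a rs \<Longrightarrow> length rs = k \<Longrightarrow> length as = k"
begin

text \<open>The instruction for one element of the transition function.\<close>

definition instr_of ::
  "'q \<Rightarrow> input_symbol \<Rightarrow> nat list \<Rightarrow> 'q \<times> move \<times> (nat \<times> move) list \<Rightarrow> unit instr" where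
  "instr_of q a rs = (\<lambda>(q', d, as).
     \<lparr>cur = to_nat q, inp = a, reads = rs, nxt = to_nat q', imove = d, acts = as, out = ()\<rparr>)"

text \<open>The machine in which the states are encoded by natural numbers.\<close>

definition mach :: "unit machine" where
  "mach = \<lparr>tapes = k, start = to_nat q\<^sub>0, accepting = to_nat ` F,
     instrs = {instr_of q a rs z | q a rs z.
       q \<in> Q \<and> set rs \<subseteq> {..<G} \<and> length rs = k \<and> z \<in> delta q a rs}\<rparr>"

text \<open>The configuration in state \<open>q\<close> with input head at \<open>h\<close> and work tapes \<open>ws\<close>.\<close>

definition cfg :: "'q \<Rightarrow> nat \<Rightarrow> (nat \<times> (nat \<Rightarrow> nat)) list \<Rightarrow> config" where
  "cfg q h ws = \<lparr>state = to_nat q, ipos = h, work = ws\<rparr>"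

lemma wf_mach: "wf_machine mach"
proof -
  have "(UNIV :: input_symbol set) \<subseteq> {Left_End, Sym True, Sym False, Right_End}"
  proof
    fix a :: input_symbol
    show "a \<in> {Left_End, Sym True, Sym False, Right_End}" by (cases a) auto
  qed
  then have "finite (UNIV :: input_symbol set)"
    by (rule finite_subset) simp
  then have "finite (SIGMA q : Q. SIGMA a : (UNIV :: input_symbol set).
      SIGMA rs : {rs. set rs \<subseteq> {..<G} \<and> length rs = k}. delta q a rs)"
    by (intro finite_SigmaI finite_Q finite_delta finite_lists_length_eq) auto
  moreover have "instrs mach = (\<lambda>(q, a, rs, z). instr_of q a rs z) `
      (SIGMA q : Q. SIGMA a : (UNIV :: input_symbol set).
        SIGMA rs : {rs. set rs \<subseteq> {..<G} \<and> length rs = k}. delta q a rs)"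
    unfolding mach_def by force
  ultimately have "finite (instrs mach)" by simp
  moreover have "length (reads i) = k \<and> length (acts i) = k" if i: "i \<in> instrs mach" for i
  proof -
    obtain q a rs q' d as where *: "i = instr_of q a rs (q', d, as)" "length rs = k"
        "(q', d, as) \<in> delta q a rs"
      using i unfolding mach_def by auto
    then show ?thesis using length_delta[of q' d as q a rs] by (simp add: instr_of_def)
  qed
  ultimately show ?thesis
    by (simp add: wf_machine_def) (simp add: mach_def)
qed

lemma applicable_mach:
  assumes "q \<in> Q" "length ws = k" "\<forall>w\<in>set ws. read w < G"
  shows "{i. applicable mach x (cfg q h ws) i} =
    instr_of q (input_cell x h) (map read ws) ` delta q (input_cell x h) (map read ws)"
    (is "?L = instr_of q ?a ?rs ` ?R")
proof (intro equalityI subsetI)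
  fix i assume "i \<in> ?L"
  then obtain q1 a1 rs1 z1 where "i = instr_of q1 a1 rs1 z1" "z1 \<in> delta q1 a1 rs1"
      "cur i = to_nat q" "inp i = ?a" "reads i = ?rs"
    by (auto simp: applicable_def mach_def cfg_def)
  moreover from this have "q1 = q" "a1 = ?a" "rs1 = ?rs"
    by (cases z1; simp add: instr_of_def)+
  ultimately show "i \<in> instr_of q ?a ?rs ` ?R" by simp
next
  fix i assume "i \<in> instr_of q ?a ?rs ` ?R"
  then obtain z where z: "i = instr_of q ?a ?rs z" "z \<in> ?R" by blast
  moreover have "set ?rs \<subseteq> {..<G}" "length ?rs = k" using assms by auto
  ultimately have "i \<in> instrs mach"
    using assms(1) unfolding mach_def machine.simps by blast
  moreover have "cur i = to_nat q" "inp i = ?a" "reads i = ?rs"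
    using z by (cases z; simp add: instr_of_def)+
  ultimately show "i \<in> ?L"
    by (simp add: applicable_def cfg_def)
qed

lemma inj_instr_of: "inj (instr_of q a rs)"
  by (auto simp: inj_def instr_of_def)

lemma exec_instr_of:
  "exec x (instr_of q a rs (q', d, as)) (cfg q h ws) =
     cfg q' (min (length x + 1) (shift d h)) (map2 act as ws)"
  by (simp add: exec_def instr_of_def cfg_def)

text \<open>\<^const>\<open>path_count\<close> for configurations with a structured state.\<close>

definition count :: "bool list \<Rightarrow> nat \<Rightarrow> 'q \<Rightarrow> nat \<Rightarrow> (nat \<times> (nat \<Rightarrow> nat)) list \<Rightarrow> nat \<Rightarrow> bool" where
  "count x s q h ws n \<longleftrightarrow> path_count mach x s (cfg q h ws) n"

text \<open>
  The side conditions under which the transition function determines the next step: the right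
  number of tapes, heads to the left of \<open>s\<close>, and scanned symbols of the alphabet.
\<close>

definition valid :: "nat \<Rightarrow> (nat \<times> (nat \<Rightarrow> nat)) list \<Rightarrow> bool" where
  "valid s ws \<longleftrightarrow> length ws = k \<and> (\<forall>(p, t)\<in>set ws. p < s \<and> t p < G)"

lemma count_halt:
  assumes "delta q (input_cell x h) (map read ws) = {}" "q \<in> Q" "valid s ws"
  shows "count x s q h ws (of_bool (q \<in> F))"
proof -
  have "{i. applicable mach x (cfg q h ws) i} = {}"
    using assms by (subst applicable_mach) (auto simp: valid_def)
  then have "halted mach x (cfg q h ws)" by (auto simp: halted_def)
  moreover have "\<forall>(p, t)\<in>set (work (cfg q h ws)). p < s"
    using assms by (auto simp: valid_def cfg_def)
  moreover have "state (cfg q h ws) \<in> accepting mach \<longleftrightarrow> q \<in> F"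
    by (simp add: mach_def cfg_def inj_image_mem_iff)
  ultimately show ?thesis
    using path_count.halt[of mach x "cfg q h ws" s] by (simp only: count_def)
qed

text \<open>
  The branches must lead to distinct states, because accepting paths are sequences of
  instructions: equal instructions would be counted once.
\<close>

lemma count_branch:
  assumes delta: "delta q (input_cell x h) (map read ws) = (\<lambda>j. (q' j, d j, as j)) ` J"
    and J: "finite J" "J \<noteq> {}" "inj_on q' J"
    and q: "q \<in> Q" and ws: "valid s ws"
    and succ: "\<And>j. j \<in> J \<Longrightarrow>
      count x s (q' j) (min (length x + 1) (shift (d j) h)) (map2 act (as j) ws) (f j)"
    and n: "n = sum f J"
  shows "count x s q h ws n"
proof -
  let ?g = "\<lambda>j. instr_of q (input_cell x h) (map read ws) (q' j, d j, as j)"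
  have app: "{i. applicable mach x (cfg q h ws) i} = ?g ` J"
    using q ws by (subst applicable_mach) (auto simp: valid_def delta image_image)
  have inj: "inj_on ?g J"
  proof (rule inj_onI)
    fix i j assume ij: "i \<in> J" "j \<in> J" "?g i = ?g j"
    from injD[OF inj_instr_of ij(3)] have "q' i = q' j" by simp
    then show "i = j" using J(3) ij by (simp add: inj_on_eq_iff)
  qed
  have "path_count mach x s (cfg q h ws)
      (\<Sum>i | applicable mach x (cfg q h ws) i. f (the_inv_into J ?g i))"
  proof (rule path_count.step)
    show "\<not> halted mach x (cfg q h ws)"
      using app J(2) by (auto simp: halted_def)
    show "\<forall>(p, t)\<in>set (work (cfg q h ws)). p < s"
      using ws by (auto simp: valid_def cfg_def)
    fix i assume "applicable mach x (cfg q h ws) i"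
    then obtain j where "j \<in> J" "i = ?g j" using app by auto
    then show "path_count mach x s (exec x i (cfg q h ws)) (f (the_inv_into J ?g i))"
      using succ[of j] the_inv_into_f_f[OF inj, of j] by (simp add: exec_instr_of count_def)
  qed
  also have "(\<Sum>i | applicable mach x (cfg q h ws) i. f (the_inv_into J ?g i)) = sum f J"
    unfolding app sum.reindex[OF inj]
    by (intro sum.cong refl) (simp add: the_inv_into_f_f[OF inj, simplified])
  finally show ?thesis using n by (simp add: count_def)
qed

lemma count_det:
  assumes "delta q (input_cell x h) (map read ws) = {(q', d, as)}" "q \<in> Q" "valid s ws"
    and "count x s q' (min (length x + 1) (shift d h)) (map2 act as ws) n"
  shows "count x s q h ws n"
proof (rule count_branch[where J = "{()}" and q' = "\<lambda>_. q'" and d = "\<lambda>_. d"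
        and as = "\<lambda>_. as" and f = "\<lambda>_. n"])
  show "delta q (input_cell x h) (map read ws) = (\<lambda>_. (q', d, as)) ` {()}"
    using assms(1) by simp
  show "q \<in> Q" "valid s ws" by fact+
  show "count x s q' (min (length x + 1) (shift d h)) (map2 act as ws) n" by fact
qed simp_all

end

section \<open>A binary counter on a work tape\<close>

text \<open>
  Counters are written in bijective binary, with digits \<open>1\<close> and \<open>2\<close> and the least significant
  digit first.  There are no leading zeros, so a counter is zero iff it has no digits, which is
  visible in its first cell.
\<close>

fun inc_digits :: "nat list \<Rightarrow> nat list" where
  "inc_digits [] = [1]"
| "inc_digits (d # ds) = (if d = 2 then 1 # inc_digits ds else 2 # ds)"

fun digits :: "nat \<Rightarrow> nat list" where
  "digits 0 = []"
| "digits (Suc c) = inc_digits (digits c)"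

lemma set_inc_digits: "set ds \<subseteq> {1, 2} \<Longrightarrow> set (inc_digits ds) \<subseteq> {1, 2}"
  by (induction ds) auto

lemma set_digits: "set (digits c) \<subseteq> {1, 2}"
  by (induction c) (use set_inc_digits in auto)

lemma digits_eq_Nil_iff: "digits c = [] \<longleftrightarrow> c = 0"
proof -
  have "inc_digits ds \<noteq> []" for ds by (cases ds) auto
  then show ?thesis by (cases c) auto
qed

lemma length_digits: "2 ^ length (digits c) \<le> c + 1"
proof -
  define val :: "nat list \<Rightarrow> nat" where "val ds = foldr (\<lambda>d v. d + 2 * v) ds 0" for ds
  have "val (inc_digits ds) = Suc (val ds)" if "set ds \<subseteq> {1, 2}" for ds
    using that by (induction ds) (auto simp: val_def)
  then have "val (digits c) = c"
    by (induction c) (use set_digits in \<open>auto simp: val_def\<close>)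
  moreover have "2 ^ length ds \<le> val ds + 1" if "set ds \<subseteq> {1, 2}" for ds
    using that by (induction ds) (auto simp: val_def)
  ultimately show ?thesis using set_digits by metis
qed

text \<open>The tape that holds \<open>xs\<close>, followed by blanks.\<close>

definition tape_of :: "nat list \<Rightarrow> nat \<Rightarrow> nat" where
  "tape_of xs p = (if p < length xs then xs ! p else 0)"

lemma tape_of_append_Cons [simp]:
  "tape_of (xs @ y # ys) (length xs) = y"
  "(tape_of (xs @ y # ys))(length xs := z) = tape_of (xs @ z # ys)"
  by (auto simp: tape_of_def fun_eq_iff nth_append nth_Cons split: nat.split)

lemma tape_of_blank:
  "tape_of xs (length xs) = 0"
  "(tape_of xs)(length xs := z) = tape_of (xs @ [z])"
  "tape_of (xs @ [0]) = tape_of xs"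
  by (auto simp: tape_of_def fun_eq_iff nth_append)

text \<open>
  The symbol \<open>3\<close> marks the left end.  Between operations the head rests on cell \<open>1\<close>, so that the
  scanned symbol tells whether the counter is zero (\<open>counter_tape_1\<close>).
\<close>

definition counter_tape :: "nat \<Rightarrow> nat \<Rightarrow> nat" where
  "counter_tape c = tape_of (3 # digits c)"

lemma counter_tape_1: "counter_tape c 1 = 0 \<longleftrightarrow> c = 0"
proof (cases "digits c")
  case (Cons d ds)
  moreover have "d \<in> {1, 2}" using set_digits[of c] Cons by auto
  ultimately show ?thesis
    using digits_eq_Nil_iff[of c] by (auto simp: counter_tape_def tape_of_def)
qed (use digits_eq_Nil_iff[of c] in \<open>auto simp: counter_tape_def tape_of_def\<close>)

lemma tape_of_le:
  assumes "set ds \<subseteq> {1, 2}" shows "tape_of (3 # ds) p \<le> 3"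
proof (cases "p < length (3 # ds)")
  case True
  then have "tape_of (3 # ds) p \<in> set (3 # ds)" unfolding tape_of_def by (metis nth_mem)
  then show ?thesis using assms by auto
qed (simp add: tape_of_def)

section \<open>The machine\<close>

text \<open>
  The states.  The machine is said to be \<^emph>\<open>at\<close> \<open>m\<close> in the state \<open>Walk 0\<close> if its input head is at
  \<open>m + 1\<close>, its counter is \<open>0\<close> and the other tapes are fresh.

  \<^item> \<open>Init\<close> and \<open>Scan\<close> mark the tapes and check that the input has the form \<open>1\<^sup>n\<close>.
  \<^item> \<open>Walk j\<close> moves the input head to the left end while incrementing the counter, and counts the
    steps in \<open>j\<close> up to \<open>C + 2\<close>.  At the left end, \<open>j = m + 1\<close> if \<open>m \<le> C\<close>, and \<open>j = C + 2\<close> otherwise.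
  \<^item> \<open>Sim q i e v\<close> simulates the transducer in its state \<open>q\<close> on \<open>1\<^sup>m 0 1\<^sup>i\<close>.  The virtual head is \<open>v\<close>
    cells to the right of the input head.  The path is tight for \<open>e = 0\<close> and free for \<open>e = 1\<close>
    and \<open>e = 2\<close>; the last guess of a free path is recorded only to tell its branches apart.
  \<^item> \<open>Rewind i\<close> and \<open>Erase i\<close> move the heads of the simulated tapes to the first unvisited cell,
    and back while erasing.
  \<^item> \<open>Advance i\<close> moves the input head to the right until the counter is zero, and \<open>Back j\<close>
    moves it \<open>j\<close> cells to the left.
  \<^item> \<open>Accept b\<close> is the accepting end of the \<open>b\<close>-th of the \<open>A m\<close> paths at some \<open>m \<le> C\<close>.
  \<^item> \<open>Inc q\<close> and \<open>Dec q\<close> change the counter by one and continue in \<open>q\<close>; decrementing turns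
    the digits \<open>1\<close> before the first \<open>2\<close> into \<open>2\<close>, and if there is no \<open>2\<close>, then \<open>Cut q\<close> removes
    the most significant digit.  \<open>Return q\<close> moves the counter head back.
\<close>

datatype phase =
  Init | Scan | Walk nat | Sim nat nat nat nat | Rewind nat | Erase nat | Advance nat | Back nat
  | Accept nat | Inc phase | Dec phase | Cut phase | Return phase

instance phase :: countable
  by countable_datatype

text \<open>The action that leaves the tapes unchanged.\<close>

definition keep :: "nat list \<Rightarrow> (nat \<times> move) list" where
  "keep rs = map (\<lambda>r. (r, Stay)) rs"

text \<open>
  On a simulated tape, the symbol \<open>b\<close> in a visited cell is represented by \<open>2 * b + 2\<close> in cell \<open>0\<close>
  and by \<open>2 * b + 1\<close> elsewhere; \<open>0\<close> stands for an unvisited cell, which is blank.  \<open>plain\<close> recovers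
  \<open>b\<close>, with \<open>plain 0 = 0\<close> by truncated subtraction; \<open>marked\<close> recognizes cell \<open>0\<close>; and \<open>mark r b\<close>
  represents \<open>b\<close> in a cell that held \<open>r\<close> before.
\<close>

definition plain :: "nat \<Rightarrow> nat" where
  "plain r = (r - 1) div 2"

definition marked :: "nat \<Rightarrow> bool" where
  "marked r \<longleftrightarrow> r \<noteq> 0 \<and> even r"

definition mark :: "nat \<Rightarrow> nat \<Rightarrow> nat" where
  "mark r b = (if marked r then 2 * b + 2 else 2 * b + 1)"

text \<open>
  The symbol under the virtual head, given the scanned input symbol \<open>a\<close>, the scanned counter
  symbol \<open>r\<close> and the offset \<open>v\<close>.
\<close>

definition virtual_symbol :: "input_symbol \<Rightarrow> nat \<Rightarrow> nat \<Rightarrow> nat \<Rightarrow> input_symbol" where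
  "virtual_symbol a r i v =
     (if a = Left_End then Left_End else if r \<noteq> 0 then Sym True
      else if v = 0 then Sym False else if v \<le> i then Sym True else Right_End)"

text \<open>
  The next state and the move of the input head when the simulated transducer goes to state \<open>q\<close>
  and moves its head.  To the left of the separating \<open>0\<close>, the counter is adjusted so that the
  sum of its value and the head position stays the same.
\<close>

fun virtual_move :: "move \<Rightarrow> input_symbol \<Rightarrow> nat \<Rightarrow> nat \<Rightarrow> nat \<Rightarrow> nat \<Rightarrow> nat \<Rightarrow> phase \<times> move" where
  "virtual_move Stay a r i v q e = (Sim q i e v, Stay)"
| "virtual_move Go_Right a r i v q e =
     (if r = 0 then (Sim q i e (min (v + 1) (i + 1)), Stay) else (Dec (Sim q i e 0), Go_Right))"
| "virtual_move Go_Left a r i v q e =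
     (if v > 0 then (Sim q i e (v - 1), Stay)
      else if a = Left_End then (Sim q i e 0, Stay) else (Inc (Sim q i e 0), Go_Left))"

text \<open>
  The possible values of \<open>e\<close> after an optional output bit: a tight path stays tight by guessing
  the output bit and becomes free by guessing \<open>0\<close> below the output bit \<open>1\<close>; on a free path both
  guesses are possible.
\<close>

fun guesses :: "bool option \<Rightarrow> nat \<Rightarrow> nat set" where
  "guesses None e = {e}"
| "guesses (Some b) e = (if e \<noteq> 0 then {1, 2} else if b then {0, 1} else {0})"

text \<open>
  \<open>M\<close> is the transducer for the coefficients; of \<open>A\<close>, only the values up to \<open>C\<close> enter the
  construction.  At the left end in \<open>Walk j\<close>, the value \<open>j - 1\<close> is \<open>m\<close>.
\<close>

locale recurrence_machine =
  fixes M :: "bool option machine" and C :: nat and A :: "nat \<Rightarrow> nat"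
  assumes wf: "wf_machine M" and det: "deterministic M"
begin

text \<open>The instructions of the transducer that apply; there is at most one.\<close>

definition matching :: "nat \<Rightarrow> input_symbol \<Rightarrow> nat list \<Rightarrow> bool option instr set" where
  "matching q a rs = {I \<in> instrs M. cur I = q \<and> inp I = a \<and> reads I = rs}"

text \<open>
  The first tape is the counter, and the remaining ones simulate the work tapes of \<open>M\<close>.  When \<open>M\<close>
  halts on a tight path there is no next step, so that this path rejects.
\<close>

fun delta :: "phase \<Rightarrow> input_symbol \<Rightarrow> nat list \<Rightarrow> (phase \<times> move \<times> (nat \<times> move) list) set" where
  "delta q a [] = {}"
| "delta Init a (r # rs) = {(Scan, Go_Right, (3, Go_Right) # map (\<lambda>_. (2, Stay)) rs)}"
| "delta Scan a (r # rs) =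
     (if a = Sym True then {(Scan, Go_Right, keep (r # rs))}
      else if a = Right_End then {(Walk 0, Stay, keep (r # rs))} else {})"
| "delta (Walk j) a (r # rs) =
     (if a \<noteq> Left_End then {(Inc (Walk (min (C + 2) (Suc j))), Go_Left, keep (r # rs))}
      else if j \<le> C + 1 then (\<lambda>b. (Accept b, Stay, keep (r # rs))) ` {..<A (j - 1)}
      else (\<lambda>i. (Sim (start M) i 0 0, Stay, keep (r # rs))) ` {1..C})"
| "delta (Sim q i e v) a (r # rs) =
     (let J = matching q (virtual_symbol a r i v) (map plain rs) in
      if J = {} then (if e = 0 then {} else {(Rewind i, Stay, keep (r # rs))})
      else (\<Union>I\<in>J. (\<lambda>e'. (fst (virtual_move (imove I) a r i v (nxt I) e'),
        snd (virtual_move (imove I) a r i v (nxt I) e'),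
        (r, Stay) # map2 (\<lambda>s (b, d). (mark s b, d)) rs (acts I))) ` guesses (out I) e))"
| "delta (Rewind i) a (r # rs) =
     (if \<forall>s\<in>set rs. s = 0 then {(Erase i, Stay, keep (r # rs))}
      else {(Rewind i, Stay,
        (r, Stay) # map (\<lambda>s. (s, if s = 0 then Stay else Go_Right)) rs)})"
| "delta (Erase i) a (r # rs) =
     (if \<forall>s\<in>set rs. marked s then {(Advance i, Stay, (r, Stay) # map (\<lambda>_. (2, Stay)) rs)}
      else {(Erase i, Stay,
        (r, Stay) # map (\<lambda>s. if marked s then (2, Stay) else (0, Go_Left)) rs)})"
| "delta (Advance i) a (r # rs) =
     (if r = 0 then {(Back i, Stay, keep (r # rs))}
      else {(Dec (Advance i), Go_Right, keep (r # rs))})"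
| "delta (Back j) a (r # rs) =
     (if j = 0 then {(Walk 0, Stay, keep (r # rs))} else {(Back (j - 1), Go_Left, keep (r # rs))})"
| "delta (Accept b) a (r # rs) = {}"
| "delta (Inc q) a (r # rs) =
     (if r = 2 then {(Inc q, Stay, (1, Go_Right) # keep rs)}
      else {(Return q, Stay, (Suc r, Stay) # keep rs)})"
| "delta (Dec q) a (r # rs) =
     (if r = 1 then {(Dec q, Stay, (2, Go_Right) # keep rs)}
      else if r = 2 then {(Return q, Stay, (1, Stay) # keep rs)}
      else {(Cut q, Stay, (r, Go_Left) # keep rs)})"
| "delta (Cut q) a (r # rs) = {(Return q, Stay, (0, Go_Left) # keep rs)}"
| "delta (Return q) a (r # rs) =
     (if r = 3 then {(q, Stay, (3, Go_Right) # keep rs)}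
      else {(Return q, Stay, (r, Go_Left) # keep rs)})"

text \<open>The states in use, apart from the counter operations that continue in them.\<close>

fun basic :: "phase \<Rightarrow> bool" where
  "basic (Walk j) \<longleftrightarrow> j \<le> C + 2"
| "basic (Sim q i e v) \<longleftrightarrow>
     q \<in> insert (start M) (nxt ` instrs M) \<and> i \<le> C \<and> e \<le> 2 \<and> v \<le> C + 1"
| "basic (Accept b) \<longleftrightarrow> (\<exists>m\<le>C. b < A m)"
| "basic Init \<longleftrightarrow> True"
| "basic Scan \<longleftrightarrow> True"
| "basic (Rewind i) \<longleftrightarrow> i \<le> C"
| "basic (Erase i) \<longleftrightarrow> i \<le> C"
| "basic (Advance i) \<longleftrightarrow> i \<le> C"
| "basic (Back i) \<longleftrightarrow> i \<le> C"
| "basic _ \<longleftrightarrow> False"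

definition phases :: "phase set" where
  "phases = (\<Union>q\<in>{q. basic q}. {q, Inc q, Dec q, Cut q, Return q})"

text \<open>A strict upper bound on all symbols that are written.\<close>

definition alphabet_bound :: nat where
  "alphabet_bound =
     Suc (Max (insert 3 (\<Union>I\<in>instrs M. (\<lambda>(b, d). 2 * b + 2) ` set (acts I))))"

lemma finite_instrs: "finite (instrs M)"
  using wf by (simp add: wf_machine_def)

lemma finite_phases: "finite phases"
proof -
  let ?S = "(\<lambda>(q, i, e, v). Sim q i e v) `
    (insert (start M) (nxt ` instrs M) \<times> {..C} \<times> {..2} \<times> {..C + 1})"
  have "q \<in> ?S \<union> ({Init, Scan} \<union> Walk ` {..C + 2} \<union> Rewind ` {..C} \<union> Erase ` {..C} \<union>
      Advance ` {..C} \<union> Back ` {..C} \<union> (\<Union>m\<le>C. Accept ` {..<A m}))" if "basic q" for q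
  proof (cases "q \<in> range (\<lambda>(q, i, e, v). Sim q i e v)")
    case True
    then obtain q' i e v where "q = Sim q' i e v" by auto
    with that have "q \<in> ?S" by (intro image_eqI[of _ _ "(q', i, e, v)"]) auto
    then show ?thesis by blast
  next
    case False
    show ?thesis using that
    proof (cases q)
      case (Sim q' i e v)
      then have "q = (\<lambda>(q, i, e, v). Sim q i e v) (q', i, e, v)" by simp
      then show ?thesis using False by blast
    qed auto
  qed
  then have "{q. basic q} \<subseteq> ?S \<union> ({Init, Scan} \<union> Walk ` {..C + 2} \<union> Rewind ` {..C} \<union>
      Erase ` {..C} \<union> Advance ` {..C} \<union> Back ` {..C} \<union> (\<Union>m\<le>C. Accept ` {..<A m}))"
    by blast
  then have "finite {q. basic q}"
    by (rule finite_subset) (use finite_instrs in auto)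
  then show ?thesis by (simp add: phases_def)
qed

lemma finite_alphabet:
  "finite (insert 3 (\<Union>I\<in>instrs M. (\<lambda>(b, d). 2 * b + 2) ` set (acts I)))"
  using finite_instrs by auto

lemma alphabet_bound_gt: "3 < alphabet_bound"
  unfolding alphabet_bound_def using Max_ge[OF finite_alphabet, of 3] by simp

lemma mark_less:
  assumes "I \<in> instrs M" "(b, d) \<in> set (acts I)"
  shows "mark r b < alphabet_bound"
proof -
  have "2 * b + 2 \<le> Max (insert 3 (\<Union>I\<in>instrs M. (\<lambda>(b, d). 2 * b + 2) ` set (acts I)))"
    using assms by (intro Max_ge[OF finite_alphabet]) force
  then show ?thesis by (simp add: alphabet_bound_def mark_def)
qed

lemma finite_guesses: "finite (guesses b e)"
  by (cases b) auto

lemma finite_delta: "finite (delta q a rs)"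
proof (cases rs)
  case (Cons r rs')
  have "finite (matching s b us)" for s b us
    unfolding matching_def using finite_instrs by simp
  then show ?thesis
    using Cons by (cases q) (simp_all add: Let_def finite_guesses)
qed simp

lemma length_delta:
  assumes "(q', d, as) \<in> delta q a rs" "length rs = Suc (tapes M)"
  shows "length as = Suc (tapes M)"
proof -
  obtain r rs' where rs: "rs = r # rs'" "length rs' = tapes M"
    using assms by (cases rs) auto
  have "length (acts I) = tapes M" if "I \<in> matching s b us" for I s b us
    using that wf by (auto simp: matching_def wf_machine_def)
  then show ?thesis
    using assms(1) rs by (cases q) (auto simp: Let_def keep_def split: if_splits)
qed

end

sublocale recurrence_machine \<subseteq>
  program "Suc (tapes M)" alphabet_bound phases "range Accept" Init delta
  by unfold_locales (use finite_phases finite_delta length_delta in auto)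

context recurrence_machine
begin

definition valid_tapes :: "nat \<Rightarrow> (nat \<times> (nat \<Rightarrow> nat)) list \<Rightarrow> bool" where
  "valid_tapes s ws \<longleftrightarrow>
     length ws = tapes M \<and> (\<forall>(p, t)\<in>set ws. p < s \<and> t p < alphabet_bound)"

lemma valid_Cons:
  "valid s ((p, t) # ws) \<longleftrightarrow> p < s \<and> t p < alphabet_bound \<and> valid_tapes s ws"
  by (auto simp: valid_def valid_tapes_def)

lemma phases_intros:
  assumes "basic q"
  shows "q \<in> phases" "Inc q \<in> phases" "Dec q \<in> phases" "Cut q \<in> phases" "Return q \<in> phases"
  using assms by (auto simp: phases_def)

lemma map2_act:
  "map2 act (map f (map read ws)) ws = map (\<lambda>w. act (f (read w)) w) ws"
  by (induction ws) auto

lemma map2_act_keep [simp]: "map2 act (keep (map read ws)) ws = ws"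
  unfolding keep_def map2_act by (rule map_idI) auto

lemma count_counter_step:
  assumes "delta q (input_cell x h) (t p # map read ws) = {(q', d, (b, d') # keep (map read ws))}"
    and "q \<in> phases" "p < s" "t p < alphabet_bound" "valid_tapes s ws"
    and "count x s q' (min (length x + 1) (shift d h)) ((shift d' p, t(p := b)) # ws) n"
  shows "count x s q h ((p, t) # ws) n"
  by (rule count_det[where q' = q' and d = d and as = "(b, d') # keep (map read ws)"])
    (use assms in \<open>simp_all add: valid_Cons\<close>)

text \<open>
  The lemmas about the individual states reason backwards: a state has \<open>n\<close> accepting paths if the
  state in which its task is completed has \<open>n\<close> accepting paths.
\<close>

lemma count_Return:
  assumes "basic q" "h \<le> length x + 1" "valid_tapes s ws" "set ds \<subseteq> {1, 2}"
    and "p < s" and q: "count x s q h ((1, tape_of (3 # ds)) # ws) n"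
  shows "count x s (Return q) h ((p, tape_of (3 # ds)) # ws) n"
  using \<open>p < s\<close>
proof (induction p)
  case 0
  have "tape_of (3 # ds) 0 = 3" by (simp add: tape_of_def)
  then show ?case
    using assms 0 phases_intros(5)[OF assms(1)] alphabet_bound_gt fun_upd_triv[of "tape_of (3 # ds)" 0]
    by - (rule count_counter_step[where q' = q and d = Stay and b = 3 and d' = Go_Right],
      simp_all del: fun_upd_apply)
next
  case (Suc p)
  have "tape_of (3 # ds) (Suc p) \<noteq> 3"
  proof (cases "p < length ds")
    case True
    then have "ds ! p \<in> {1, 2}" using assms(4) nth_mem by blast
    then show ?thesis using True by (auto simp: tape_of_def)
  qed (simp add: tape_of_def)
  then show ?case
    using assms Suc phases_intros(5)[OF assms(1)] alphabet_bound_gt tape_of_le[OF assms(4), of "Suc p"]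
    by - (rule count_counter_step[where q' = "Return q" and d = Stay
          and b = "tape_of (3 # ds) (Suc p)" and d' = Go_Left],
      simp_all)
qed

text \<open>
  The list \<open>xs\<close> is the part of the tape that the carry has already passed.
\<close>

lemma count_Inc:
  assumes "basic q" "h \<le> length x + 1" "valid_tapes s ws" "set ds \<subseteq> {1, 2}"
    and "length (xs @ inc_digits ds) < s"
    and "\<And>p. p < s \<Longrightarrow> count x s (Return q) h ((p, tape_of (xs @ inc_digits ds)) # ws) n"
  shows "count x s (Inc q) h ((length xs, tape_of (xs @ ds)) # ws) n"
  using assms(4-)
proof (induction ds arbitrary: xs)
  case Nil
  then show ?case
    using assms(1-3) phases_intros(2)[OF assms(1)] alphabet_bound_gt
    by - (rule count_counter_step[where q' = "Return q" and d = Stay and b = 1 and d' = Stay],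
      simp_all add: tape_of_blank)
next
  case (Cons d ds)
  show ?case
  proof (cases "d = 2")
    case True
    have "count x s (Inc q) h ((length (xs @ [1]), tape_of ((xs @ [1]) @ ds)) # ws) n"
      using Cons.prems True by (intro Cons.IH) auto
    then show ?thesis
      using Cons.prems True assms(1-3) phases_intros(2)[OF assms(1)] alphabet_bound_gt
      by - (rule count_counter_step[where q' = "Inc q" and d = Stay and b = 1 and d' = Go_Right],
        simp_all)
  next
    case False
    then show ?thesis
      using Cons.prems assms(1-3) phases_intros(2)[OF assms(1)] alphabet_bound_gt
      by - (rule count_counter_step[where q' = "Return q" and d = Stay and b = 2 and d' = Stay],
        simp_all)
  qed
qed

text \<open>Decrementing is described as the inverse of \<^const>\<open>inc_digits\<close>.\<close>

lemma count_Dec: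
  assumes "basic q" "h \<le> length x + 1" "valid_tapes s ws" "set ds \<subseteq> {1, 2}"
    and "length (xs @ inc_digits ds) < s"
    and "\<And>p. p < s \<Longrightarrow> count x s (Return q) h ((p, tape_of (xs @ ds)) # ws) n"
  shows "count x s (Dec q) h ((length xs, tape_of (xs @ inc_digits ds)) # ws) n"
  using assms(4-)
proof (induction ds arbitrary: xs)
  case Nil
  have "count x s (Cut q) h ((length xs, tape_of (xs @ [2])) # ws) n"
    using Nil assms(1-3) phases_intros(4)[OF assms(1)] alphabet_bound_gt
    by - (rule count_counter_step[where q' = "Return q" and d = Stay and b = 0 and d' = Go_Left],
      simp_all add: tape_of_blank)
  then have "count x s (Dec q) h ((length (xs @ [2]), tape_of (xs @ [2])) # ws) n"
    using Nil assms(1-3) phases_intros(3)[OF assms(1)] alphabet_bound_gt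
      fun_upd_triv[of "tape_of (xs @ [2])" "length (xs @ [2])"]
    by - (rule count_counter_step[where q' = "Cut q" and d = Stay and b = 0 and d' = Go_Left],
      simp_all only: tape_of_blank, simp_all)
  then show ?case
    using Nil assms(1-3) phases_intros(3)[OF assms(1)] alphabet_bound_gt
    by - (rule count_counter_step[where q' = "Dec q" and d = Stay and b = 2 and d' = Go_Right],
      simp_all)
next
  case (Cons d ds)
  show ?case
  proof (cases "d = 2")
    case True
    have "count x s (Dec q) h ((length (xs @ [2]), tape_of ((xs @ [2]) @ inc_digits ds)) # ws) n"
      using Cons.prems True by (intro Cons.IH) auto
    then show ?thesis
      using Cons.prems True assms(1-3) phases_intros(3)[OF assms(1)] alphabet_bound_gt
      by - (rule count_counter_step[where q' = "Dec q" and d = Stay and b = 2 and d' = Go_Right],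
        simp_all)
  next
    case False
    then show ?thesis
      using Cons.prems assms(1-3) phases_intros(3)[OF assms(1)] alphabet_bound_gt
      by - (rule count_counter_step[where q' = "Return q" and d = Stay and b = 1 and d' = Stay],
        simp_all)
  qed
qed

lemma count_Inc_counter:
  assumes "basic q" "h \<le> length x + 1" "valid_tapes s ws"
    and "length (digits (Suc c)) + 1 < s" "count x s q h ((1, counter_tape (Suc c)) # ws) n"
  shows "count x s (Inc q) h ((1, counter_tape c) # ws) n"
  using count_Inc[of q h x s ws "digits c" "[3]" n] count_Return[of q h x s ws "digits (Suc c)" _ n]
    set_digits[of c] set_digits[of "Suc c"] assms
  by (simp add: counter_tape_def)

lemma count_Dec_counter:
  assumes "basic q" "h \<le> length x + 1" "valid_tapes s ws"
    and "length (digits (Suc c)) + 1 < s" "count x s q h ((1, counter_tape c) # ws) n"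
  shows "count x s (Dec q) h ((1, counter_tape (Suc c)) # ws) n"
  using count_Dec[of q h x s ws "digits c" "[3]" n] count_Return[of q h x s ws "digits c" _ n]
    set_digits[of c] assms
  by (simp add: counter_tape_def)

end

section \<open>Clearing the simulated tapes\<close>

context recurrence_machine
begin

text \<open>
  \<open>shape l t\<close>: the visited cells of the simulated tape \<open>t\<close> are the first \<open>l\<close> cells, and exactly
  cell \<open>0\<close> is marked.
\<close>

definition shape :: "nat \<Rightarrow> (nat \<Rightarrow> nat) \<Rightarrow> bool" where
  "shape l t \<longleftrightarrow> 1 \<le> l \<and> (\<forall>j. t j \<noteq> 0 \<longleftrightarrow> j < l) \<and> (\<forall>j. marked (t j) \<longleftrightarrow> j = 0) \<and>
     (\<forall>j. t j < alphabet_bound)"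

text \<open>Only cell \<open>0\<close> is visited; it holds a blank, represented by \<open>2\<close>.\<close>

definition fresh_tapes :: "(nat \<times> (nat \<Rightarrow> nat)) list" where
  "fresh_tapes = replicate (tapes M) (0, tape_of [2])"

text \<open>The first tape represents the second one, and at most \<open>S\<close> of its cells are visited.\<close>

fun simulates :: "nat \<Rightarrow> nat \<times> (nat \<Rightarrow> nat) \<Rightarrow> nat \<times> (nat \<Rightarrow> nat) \<Rightarrow> bool" where
  "simulates S (p', t') (p, t) \<longleftrightarrow>
     p' = p \<and> (\<exists>l\<le>S. shape l t' \<and> p \<le> l) \<and> (\<forall>j. plain (t' j) = t j)"

lemma shapeD:
  assumes "shape l t"
  shows "0 < l" "t j = 0 \<longleftrightarrow> l \<le> j" "marked (t j) \<longleftrightarrow> j = 0" "t j < alphabet_bound"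
proof -
  have "t j \<noteq> 0 \<longleftrightarrow> j < l" using assms unfolding shape_def by blast
  then show "t j = 0 \<longleftrightarrow> l \<le> j" by linarith
qed (use assms in \<open>auto simp: shape_def\<close>)

lemma valid_tapes_shape:
  assumes "length ws = tapes M" "S < s"
    and "\<And>p t. (p, t) \<in> set ws \<Longrightarrow> \<exists>l\<le>S. shape l t \<and> p \<le> l"
  shows "valid_tapes s ws"
proof -
  have "p < s \<and> t p < alphabet_bound" if "(p, t) \<in> set ws" for p t
    using assms(2) assms(3)[OF that] shapeD(4) by auto
  then show ?thesis using assms(1) by (auto simp: valid_tapes_def)
qed

lemma shape_fresh: "shape 1 (tape_of [2])"
  using alphabet_bound_gt by (auto simp: shape_def tape_of_def marked_def)

lemma valid_fresh_tapes: "0 < s \<Longrightarrow> valid_tapes s fresh_tapes"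
  using shape_fresh by (auto simp: valid_tapes_def fresh_tapes_def shape_def)

lemma valid_counter: "1 < s \<Longrightarrow> valid s ((1, counter_tape c) # ws) \<longleftrightarrow> valid_tapes s ws"
  using tape_of_le[OF set_digits, of c 1] alphabet_bound_gt
  by (simp add: valid_Cons counter_tape_def)

lemma count_tapes_step:
  assumes "delta q (input_cell x h) (counter_tape c 1 # map read ws) =
      {(q', d, (counter_tape c 1, Stay) # map f (map read ws))}"
    and "basic q" "1 < s" "valid_tapes s ws"
    and "count x s q' (min (length x + 1) (shift d h))
      ((1, counter_tape c) # map (\<lambda>w. act (f (read w)) w) ws) n"
  shows "count x s q h ((1, counter_tape c) # ws) n"
proof (rule count_det[OF _ phases_intros(1)[OF assms(2)]])
  show "delta q (input_cell x h) (map read ((1, counter_tape c) # ws)) =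
      {(q', d, (counter_tape c 1, Stay) # map f (map read ws))}"
    using assms(1) by simp
  show "valid s ((1, counter_tape c) # ws)"
    using assms(3,4) by (simp only: valid_counter)
  show "count x s q' (min (length x + 1) (shift d h))
      (map2 act ((counter_tape c 1, Stay) # map f (map read ws)) ((1, counter_tape c) # ws)) n"
    using assms(5) unfolding zip_Cons_Cons list.map(2) map2_act by simp
qed

lemma count_keep_step:
  assumes "delta q (input_cell x h) (counter_tape c 1 # map read ws) =
      {(q', d, keep (counter_tape c 1 # map read ws))}"
    and "basic q" "1 < s" "valid_tapes s ws"
    and "count x s q' (min (length x + 1) (shift d h)) ((1, counter_tape c) # ws) n"
  shows "count x s q h ((1, counter_tape c) # ws) n"
  by (rule count_tapes_step[where f = "\<lambda>r. (r, Stay)"])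
    (use assms in \<open>simp_all add: keep_def case_prod_beta\<close>)

lemma count_stay:
  assumes "delta q (input_cell x h) (counter_tape c 1 # map read ws) =
      {(q', Stay, (counter_tape c 1, Stay) # map f (map read ws))}"
    and "basic q" "1 < s" "valid_tapes s ws" "h \<le> length x + 1"
    and "count x s q' h ((1, counter_tape c) # map (\<lambda>w. act (f (read w)) w) ws) n"
  shows "count x s q h ((1, counter_tape c) # ws) n"
proof (rule count_tapes_step[OF assms(1-4)])
  have "min (length x + 1) (shift Stay h) = h" using assms(5) by simp
  then show "count x s q' (min (length x + 1) (shift Stay h))
      ((1, counter_tape c) # map (\<lambda>w. act (f (read w)) w) ws) n"
    using assms(6) by (simp only:)
qed

lemma act_keep: "map (\<lambda>w. act ((\<lambda>r. (r, Stay)) (read w)) w) ws = ws"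
  by (rule map_idI) auto

text \<open>
  All tapes move at once, so \<open>b\<close> bounds the number of steps that remain for the slowest one.
\<close>

lemma count_Rewind:
  assumes "i \<le> C" "1 < s" "S < s" "h \<le> length x + 1"
    and "length ws = tapes M" "\<forall>(p, t)\<in>set ws. \<exists>l\<le>S. shape l t \<and> p \<le> l \<and> l \<le> p + b"
    and Erase: "\<And>ws'. length ws' = tapes M \<Longrightarrow> \<forall>(p, t)\<in>set ws'. p \<le> S \<and> shape p t \<Longrightarrow>
      count x s (Erase i) h ((1, counter_tape c) # ws') n"
  shows "count x s (Rewind i) h ((1, counter_tape c) # ws) n"
  using assms(5,6)
proof (induction b arbitrary: ws)
  case (0 ws)
  have at_end: "p \<le> S \<and> shape p t" if "(p, t) \<in> set ws" for p t
    using bspec[OF 0(2) that] by (auto dest: le_antisym)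
  have valid: "valid_tapes s ws"
    using at_end by (intro valid_tapes_shape[OF 0(1) \<open>S < s\<close>]) blast
  have "read w = 0" if "w \<in> set ws" for w
    using at_end[of "fst w" "snd w"] that shapeD(2)[of "fst w" "snd w" "fst w"]
    by (simp add: case_prod_beta)
  then have "delta (Rewind i) (input_cell x h) (counter_tape c 1 # map read ws) =
      {(Erase i, Stay, (counter_tape c 1, Stay) # map (\<lambda>r. (r, Stay)) (map read ws))}"
    by (simp add: keep_def)
  moreover have "count x s (Erase i) h ((1, counter_tape c) # ws) n"
    using at_end by (intro Erase 0(1)) blast
  ultimately show ?case
    using assms(1,2,4) valid 
    by - (rule count_stay[where f = "\<lambda>r. (r, Stay)" and q' = "Erase i"],
      simp_all only: act_keep basic.simps)
next
  case (Suc b ws)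
  have valid: "valid_tapes s ws"
  proof (rule valid_tapes_shape[OF Suc.prems(1) \<open>S < s\<close>])
    fix p t assume "(p, t) \<in> set ws"
    from bspec[OF Suc.prems(2) this] show "\<exists>l\<le>S. shape l t \<and> p \<le> l" by auto
  qed
  show ?case
  proof (cases "\<forall>r\<in>set (map read ws). r = 0")
    case True
    have at_end: "p \<le> S \<and> shape p t" if pt: "(p, t) \<in> set ws" for p t
    proof -
      obtain l where l: "l \<le> S" "shape l t" "p \<le> l" using bspec[OF Suc.prems(2) pt] by auto
      have "t p = 0" using True pt by force
      then have "p = l" using l shapeD(2)[OF l(2), of p] by simp
      then show ?thesis using l by simp
    qed
    have "delta (Rewind i) (input_cell x h) (counter_tape c 1 # map read ws) =
        {(Erase i, Stay, (counter_tape c 1, Stay) # map (\<lambda>r. (r, Stay)) (map read ws))}"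
      using True by (simp add: keep_def)
    moreover have "count x s (Erase i) h ((1, counter_tape c) # ws) n"
      using at_end by (intro Erase Suc.prems(1)) blast
    ultimately show ?thesis
      using assms(1,2,4) valid 
      by - (rule count_stay[where f = "\<lambda>r. (r, Stay)" and q' = "Erase i"],
        simp_all only: act_keep basic.simps)
  next
    case False
    let ?f = "\<lambda>r. (r, if r = 0 then Stay else Go_Right)"
    let ?ws = "map (\<lambda>w. act (?f (read w)) w) ws"
    have "\<forall>(p, t)\<in>set ?ws. \<exists>l\<le>S. shape l t \<and> p \<le> l \<and> l \<le> p + b"
    proof
      fix w' assume "w' \<in> set ?ws"
      then obtain p t where w: "(p, t) \<in> set ws" "w' = act (?f (t p)) (p, t)" by auto
      obtain l where l: "l \<le> S" "shape l t" "p \<le> l" "l \<le> p + Suc b"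
        using bspec[OF Suc.prems(2) w(1)] by auto
      then show "case w' of (p, t) \<Rightarrow> \<exists>l\<le>S. shape l t \<and> p \<le> l \<and> l \<le> p + b"
      proof (cases "p = l")
        case True
        then have "t p = 0" using shapeD(2)[OF l(2)] by simp
        then have "w' = (p, t)" using w by (simp add: fun_upd_idem)
        then show ?thesis using l True by auto
      next
        case False
        then have "t p \<noteq> 0" using l(3) shapeD(2)[OF l(2)] by simp
        then have "w' = (p + 1, t)" using w by simp
        then show ?thesis using l False by auto
      qed
    qed
    then have "count x s (Rewind i) h ((1, counter_tape c) # ?ws) n"
      by (intro Suc.IH) (simp_all add: Suc.prems(1))
    moreover have "delta (Rewind i) (input_cell x h) (counter_tape c 1 # map read ws) =
        {(Rewind i, Stay, (counter_tape c 1, Stay) # map ?f (map read ws))}"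
      using False by (subst delta.simps) (simp only: if_False)
    ultimately show ?thesis
      using assms(1,2,4) valid by - (rule count_stay[where f = ?f], simp_all only: basic.simps)
  qed
qed

lemma not_marked_0: "\<not> marked 0"
  by (simp add: marked_def)

lemma shape_1_fresh:
  assumes "shape 1 t" shows "t(0 := 2) = tape_of [2]"
proof
  fix p show "(t(0 := 2)) p = tape_of [2] p"
    using shapeD(2)[OF assms, of p] by (cases p) (simp_all add: tape_of_def)
qed

text \<open>
  During the erasure, a head is on the last visited cell, or on the first unvisited one before
  its first step.  A head that has reached cell \<open>0\<close> waits there for the others.
\<close>

lemma count_Erase:
  assumes "i \<le> C" "1 < s" "S < s" "h \<le> length x + 1"
    and "length ws = tapes M"
    and "\<forall>(p, t)\<in>set ws. p \<le> b \<and> (\<exists>l\<le>S. shape l t \<and> (p = l \<or> p + 1 = l))"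
    and Advance: "count x s (Advance i) h ((1, counter_tape c) # fresh_tapes) n"
  shows "count x s (Erase i) h ((1, counter_tape c) # ws) n"
  using assms(5,6)
proof (induction b arbitrary: ws)
  case (0 ws)
  have start: "p = 0 \<and> shape 1 t" if pt: "(p, t) \<in> set ws" for p t
  proof -
    have "p = 0 \<and> (\<exists>l. shape l t \<and> (p = l \<or> p + 1 = l))"
      using bspec[OF 0(2) pt] by blast
    then obtain l where l: "p = 0" "shape l t" "0 = l \<or> 0 + 1 = l" by blast
    then have "l = 1" using shapeD(1)[OF l(2)] by linarith
    with l show ?thesis by simp
  qed
  have valid: "valid_tapes s ws"
  proof (rule valid_tapes_shape[OF 0(1), of 1])
    fix p t assume "(p, t) \<in> set ws"
    from start[OF this] show "\<exists>l\<le>1. shape l t \<and> p \<le> l" by (intro exI[of _ 1]) simp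
  qed fact
  have "marked (read w)" if "w \<in> set ws" for w
    using start[of "fst w" "snd w"] that shapeD(3)[of 1 "snd w" 0] by (simp add: case_prod_beta)
  then have "delta (Erase i) (input_cell x h) (counter_tape c 1 # map read ws) =
      {(Advance i, Stay, (counter_tape c 1, Stay) # map (\<lambda>_. (2, Stay)) (map read ws))}"
    by simp
  moreover have "act (2, Stay) w = (0, tape_of [2])" if "w \<in> set ws" for w
    using start[of "fst w" "snd w"] that shape_1_fresh[of "snd w"] by (simp add: case_prod_beta)
  then have "map (\<lambda>w. act (2, Stay) w) ws = fresh_tapes"
    unfolding fresh_tapes_def using 0(1) by (intro replicate_eqI) auto
  ultimately show ?case
    using assms(1,2,4) valid Advance
    by - (rule count_stay[where f = "\<lambda>_. (2, Stay)" and q' = "Advance i"], simp_all only: basic.simps)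
next
  case (Suc b ws)
  have tape: "\<exists>l\<le>S. shape l t \<and> (p = l \<or> p + 1 = l) \<and> p \<le> Suc b" if "(p, t) \<in> set ws" for p t
    using bspec[OF Suc.prems(2) that] by blast
  have valid: "valid_tapes s ws"
  proof (rule valid_tapes_shape[OF Suc.prems(1) \<open>S < s\<close>])
    fix p t assume "(p, t) \<in> set ws"
    from tape[OF this] show "\<exists>l\<le>S. shape l t \<and> p \<le> l" by (metis add_leE order_refl)
  qed
  have marked: "marked (t p) \<longleftrightarrow> p = 0" if "(p, t) \<in> set ws" for p t
    using tape[OF that] shapeD(3) by auto
  have start: "t(0 := 2) = tape_of [2]" if "(0, t) \<in> set ws" for t
  proof -
    obtain l where l: "shape l t" "0 = l \<or> 0 + 1 = l" using tape[OF \<open>(0, t) \<in> set ws\<close>] by blast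
    then have "l = 1" using shapeD(1)[OF l(1)] by linarith
    with l show ?thesis using shape_1_fresh by simp
  qed
  show ?case
  proof (cases "\<forall>r\<in>set (map read ws). marked r")
    case True
    have "act (2, Stay) w = (0, tape_of [2])" if w: "w \<in> set ws" for w
    proof -
      obtain p t where pt: "w = (p, t)" by (cases w)
      then have "p = 0" using True w marked[of p t] by force
      then show ?thesis using start[of t] w pt by simp
    qed
    then have "map (\<lambda>w. act (2, Stay) w) ws = fresh_tapes"
      unfolding fresh_tapes_def using Suc.prems(1) by (intro replicate_eqI) auto
    moreover have "delta (Erase i) (input_cell x h) (counter_tape c 1 # map read ws) =
        {(Advance i, Stay, (counter_tape c 1, Stay) # map (\<lambda>_. (2, Stay)) (map read ws))}"
      using True by simp
    ultimately show ?thesis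
      using assms(1,2,4) valid Advance
      by - (rule count_stay[where f = "\<lambda>_. (2, Stay)" and q' = "Advance i"], simp_all only: basic.simps)
  next
    case False
    let ?f = "\<lambda>r. if marked r then (2, Stay) else (0, Go_Left)"
    let ?ws = "map (\<lambda>w. act (?f (read w)) w) ws"
    have "\<forall>(p, t)\<in>set ?ws. p \<le> b \<and> (\<exists>l\<le>S. shape l t \<and> (p = l \<or> p + 1 = l))"
    proof
      fix w' assume "w' \<in> set ?ws"
      then obtain p t where w: "(p, t) \<in> set ws" "w' = act (?f (t p)) (p, t)" by auto
      obtain l where l: "l \<le> S" "shape l t" "p = l \<or> p + 1 = l" "p \<le> Suc b"
        using tape[OF w(1)] by blast
      show "case w' of (p, t) \<Rightarrow> p \<le> b \<and> (\<exists>l\<le>S. shape l t \<and> (p = l \<or> p + 1 = l))"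
      proof (cases "p = 0")
        case True
        then have "w' = (0, tape_of [2])"
          using w marked[OF w(1)] start by simp
        moreover have "1 \<le> S" using l shapeD(1)[OF l(2)] by simp
        ultimately show ?thesis using shape_fresh by auto
      next
        case False
        then have "w' = (p - 1, t(p := 0))" using w marked[OF w(1)] by simp
        moreover have "shape p (t(p := 0))"
          unfolding shape_def
        proof (intro conjI allI)
          fix j
          show "(t(p := 0)) j \<noteq> 0 \<longleftrightarrow> j < p" "marked ((t(p := 0)) j) \<longleftrightarrow> j = 0"
              "(t(p := 0)) j < alphabet_bound"
            using False l(3) shapeD(2-4)[OF l(2), of j] alphabet_bound_gt not_marked_0 by auto
        qed (use False in simp)
        moreover have "p - 1 \<le> b" "p - 1 + 1 = p" "p \<le> S" using l False by auto
        ultimately show ?thesis by blast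
      qed
    qed
    then have "count x s (Erase i) h ((1, counter_tape c) # ?ws) n"
      by (intro Suc.IH) (simp_all add: Suc.prems(1))
    moreover have "delta (Erase i) (input_cell x h) (counter_tape c 1 # map read ws) =
        {(Erase i, Stay, (counter_tape c 1, Stay) # map ?f (map read ws))}"
      using False by (subst delta.simps) (simp only: if_False)
    ultimately show ?thesis
      using assms(1,2,4) valid by - (rule count_stay[where f = ?f], simp_all only: basic.simps)
  qed
qed

section \<open>Moving between consecutive arguments\<close>

lemma count_Walk:
  assumes "valid_tapes s ws" "\<And>c. c \<le> length x + 1 \<Longrightarrow> length (digits c) + 1 < s"
    and "h + c \<le> length x + 1"
    and "count x s (Walk (min (C + 2) (j + h))) 0 ((1, counter_tape (c + h)) # ws) n"
  shows "count x s (Walk (min (C + 2) j)) h ((1, counter_tape c) # ws) n"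
  using assms(3-)
proof (induction h arbitrary: j c)
  case (Suc h)
  have [simp]: "min (C + 2) (Suc (min (C + 2) j)) = min (C + 2) (Suc j)" by simp
  have "count x s (Walk (min (C + 2) (Suc j))) h ((1, counter_tape (Suc c)) # ws) n"
    using Suc.prems by (intro Suc.IH) simp_all
  then have "count x s (Inc (Walk (min (C + 2) (Suc j)))) h ((1, counter_tape c) # ws) n"
    using Suc.prems assms(1) assms(2)[of "Suc c"] by (intro count_Inc_counter) simp_all
  then show ?case
    using assms(1) assms(2)[of 0] Suc.prems
    by - (rule count_keep_step[where q' = "Inc (Walk (min (C + 2) (Suc j)))" and d = Go_Left],
      simp_all add: input_cell_def)
qed simp

lemma count_Back:
  assumes "valid_tapes s ws" "1 < s" "j \<le> C" "h \<le> length x + 1"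
    and "count x s (Walk 0) (h - j) ((1, counter_tape c) # ws) n"
  shows "count x s (Back j) h ((1, counter_tape c) # ws) n"
  using assms(3-)
proof (induction j arbitrary: h)
  case 0
  then show ?case
    using assms(1,2)
    by - (rule count_keep_step[where q' = "Walk 0" and d = Stay], simp_all)
next
  case (Suc j)
  have "count x s (Back j) (h - 1) ((1, counter_tape c) # ws) n"
    using Suc.prems by (intro Suc.IH) simp_all
  then show ?case
    using assms(1,2) Suc.prems
    by - (rule count_keep_step[where q' = "Back j" and d = Go_Left], simp_all)
qed

lemma count_Advance:
  assumes "valid_tapes s ws" "\<And>c. c \<le> length x + 1 \<Longrightarrow> length (digits c) + 1 < s"
    and "i \<le> C" "h + c \<le> length x + 1"
    and "count x s (Back i) (h + c) ((1, counter_tape 0) # ws) n"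
  shows "count x s (Advance i) h ((1, counter_tape c) # ws) n"
proof -
  have basic: "basic (Advance i)" using assms(3) by simp
  show ?thesis using assms(4-)
  proof (induction c arbitrary: h)
    case 0
    have "counter_tape 0 1 = 0" using counter_tape_1[of 0] by blast
    then show ?case
      using 0 basic assms(1) assms(2)[of 0]
      by - (rule count_keep_step[where q' = "Back i" and d = Stay], simp_all)
  next
    case (Suc c)
    have "count x s (Advance i) (Suc h) ((1, counter_tape c) # ws) n"
      using Suc.prems by (intro Suc.IH) simp_all
    then have "count x s (Dec (Advance i)) (Suc h) ((1, counter_tape (Suc c)) # ws) n"
      using Suc.prems assms(1) assms(2)[of "Suc c"] basic by (intro count_Dec_counter) simp_all
    moreover have "counter_tape (Suc c) 1 \<noteq> 0" using counter_tape_1[of "Suc c"] by blast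
    ultimately show ?case
      using Suc.prems basic assms(1) assms(2)[of 0]
      by - (rule count_keep_step[where q' = "Dec (Advance i)" and d = Go_Right], simp_all)
  qed
qed

end

section \<open>Simulating the transducer\<close>

text \<open>
  The number of ways to complete a guess when the output bits \<open>bs\<close> are still to come.
\<close>

definition weight :: "nat \<Rightarrow> bool list \<Rightarrow> nat" where
  "weight e bs = (if e = 0 then binary_value bs else 2 ^ length bs)"

lemma binary_value_Nil: "binary_value [] = 0"
  by (simp add: binary_value_def)

lemma binary_value_Cons: "binary_value (b # bs) = of_bool b * 2 ^ length bs + binary_value bs"
  by (simp add: binary_value_def horner_sum_append)

lemma sum_guesses:
  "(\<Sum>e'\<in>guesses b e. weight e' bs) = weight e (case b of None \<Rightarrow> bs | Some b \<Rightarrow> b # bs)"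
  by (cases b) (auto simp: weight_def binary_value_Cons)

lemma guesses_nonempty: "guesses b e \<noteq> {}"
  by (cases b) auto

lemma guesses_le: "e' \<in> guesses b e \<Longrightarrow> e \<le> 2 \<Longrightarrow> e' \<le> 2"
  by (cases b) (auto split: if_splits)

lemma inj_virtual_move: "inj_on (\<lambda>e. fst (virtual_move d a r i v q e)) E"
  by (cases d) (auto simp: inj_on_def)

text \<open>The input from which the transducer computes \<open>D m i\<close>.\<close>

definition argument :: "nat \<Rightarrow> nat \<Rightarrow> bool list" where
  "argument m i = ones m @ [False] @ ones i"

lemma length_argument: "length (argument m i) = m + i + 1"
  by (simp add: argument_def ones_def)

lemma input_cell_argument:
  "input_cell (argument m i) p =
    (if p = 0 then Left_End else if p \<le> m then Sym True else if p = m + 1 then Sym False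
     else if p \<le> m + i + 1 then Sym True else Right_End)"
proof -
  have "argument m i ! j \<longleftrightarrow> j \<noteq> m" if "j < m + i + 1" for j
    using that by (auto simp: argument_def ones_def nth_append nth_Cons')
  then show ?thesis by (cases p) (auto simp: input_cell_def length_argument)
qed

text \<open>
  The virtual position \<open>p\<close> is represented by the head position \<open>min p (m + 1)\<close>, the counter value
  \<open>m + 1 - p\<close> and the offset \<open>p - (m + 1)\<close>, with truncated subtraction.
\<close>

lemma virtual_symbol:
  assumes "p \<le> m + i + 2"
  shows "virtual_symbol (input_cell x (min p (m + 1))) (counter_tape (m + 1 - p) 1) i (p - (m + 1)) =
    input_cell (argument m i) p"
proof -
  have a: "input_cell x (min p (m + 1)) = Left_End \<longleftrightarrow> p = 0"
    by (auto simp: input_cell_def min_def split: if_splits)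
  have r: "counter_tape (m + 1 - p) 1 = 0 \<longleftrightarrow> m + 1 \<le> p"
    using counter_tape_1[of "m + 1 - p"] by simp
  show ?thesis
    unfolding virtual_symbol_def a r input_cell_argument using assms by auto
qed

context recurrence_machine
begin

lemma simulates_act:
  assumes sim: "simulates S (p', t') (p, t)" and "p < S"
    and I: "I \<in> instrs M" "(b, d) \<in> set (acts I)"
  shows "simulates S (act (mark (t' p') b, d) (p', t')) (act (b, d) (p, t))"
proof -
  from sim obtain l where p: "p' = p" and l: "l \<le> S" "shape l t'" "p \<le> l"
    and plain: "\<And>j. plain (t' j) = t j" by auto
  have mark: "mark (t' p) b \<noteq> 0" "marked (mark (t' p) b) \<longleftrightarrow> marked (t' p)" "plain (mark (t' p) b) = b"
    by (auto simp: mark_def marked_def plain_def)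
  have "shape (max l (p + 1)) (t'(p := mark (t' p) b))"
    unfolding shape_def
  proof (intro conjI allI)
    fix j
    show "(t'(p := mark (t' p) b)) j \<noteq> 0 \<longleftrightarrow> j < max l (p + 1)"
      using mark(1) l(3) shapeD(2)[OF l(2), of j] by auto
    show "marked ((t'(p := mark (t' p) b)) j) \<longleftrightarrow> j = 0"
      using mark(2) shapeD(3)[OF l(2), of j] by auto
    show "(t'(p := mark (t' p) b)) j < alphabet_bound"
      using mark_less[OF I] shapeD(4)[OF l(2), of j] by auto
  qed (use shapeD(1)[OF l(2)] in simp)
  moreover have "max l (p + 1) \<le> S" "shift d p \<le> max l (p + 1)"
    using l \<open>p < S\<close> by (auto, cases d, auto)
  ultimately have "\<exists>l\<le>S. shape l (t'(p := mark (t' p) b)) \<and> shift d p \<le> l" by blast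
  then show ?thesis
    using p plain mark(3) by simp
qed

lemma simulates_read:
  "list_all2 (simulates S) ws us \<Longrightarrow> map plain (map read ws) = map read us"
  by (induction rule: list_all2_induct) auto

lemma simulates_valid:
  assumes "list_all2 (simulates S) ws us" "length us = tapes M" "S < s"
  shows "valid_tapes s ws"
proof (rule valid_tapes_shape[of _ S])
  show "length ws = tapes M" using assms(1,2) by (simp add: list_all2_lengthD)
  fix p t assume "(p, t) \<in> set ws"
  then obtain u where "simulates S (p, t) u"
    using assms(1) by (metis in_set_conv_nth list_all2_nthD)
  then show "\<exists>l\<le>S. shape l t \<and> p \<le> l" by (cases u) auto
qed fact

lemma simulates_exec:
  assumes sim: "list_all2 (simulates S) ws us" and len: "length us = tapes M"
    and I: "I \<in> instrs M" and space: "\<forall>(p, t)\<in>set us. p < S"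
  shows "list_all2 (simulates S)
    (map2 act (map2 (\<lambda>r (b, d). (mark r b, d)) (map read ws) (acts I)) ws) (map2 act (acts I) us)"
proof (rule list_all2_all_nthI)
  have acts: "length (acts I) = tapes M" using wf I by (simp add: wf_machine_def)
  note lens = list_all2_lengthD[OF sim] len acts
  show "length (map2 act (map2 (\<lambda>r (b, d). (mark r b, d)) (map read ws) (acts I)) ws) =
      length (map2 act (acts I) us)"
    using lens by simp
  fix j assume "j < length (map2 act (map2 (\<lambda>r (b, d). (mark r b, d)) (map read ws) (acts I)) ws)"
  then have j: "j < length us" using lens by simp
  obtain b d where bd: "acts I ! j = (b, d)" by (cases "acts I ! j")
  obtain p' t' where w: "ws ! j = (p', t')" by (cases "ws ! j")
  obtain p t where u: "us ! j = (p, t)" by (cases "us ! j")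
  have "simulates S (p', t') (p, t)"
    using list_all2_nthD2[OF sim j] w u by simp
  moreover have "p < S" using bspec[OF space nth_mem[OF j]] u by simp
  moreover have "(b, d) \<in> set (acts I)" using bd nth_mem[of j "acts I"] j lens by simp
  ultimately have "simulates S (act (mark (t' p') b, d) (p', t')) (act (b, d) (p, t))"
    using I by (intro simulates_act)
  then show "simulates S
      (map2 act (map2 (\<lambda>r (b, d). (mark r b, d)) (map read ws) (acts I)) ws ! j)
      (map2 act (acts I) us ! j)"
    using j lens bd w u by simp
qed

lemma matching_applicable:
  assumes "applicable M y c I"
  shows "matching (state c) (input_cell y (ipos c)) (map read (work c)) = {I}"
  using assms det by (auto simp: matching_def applicable_def deterministic_def)

lemma matching_halted:
  assumes "halted M y c"
  shows "matching (state c) (input_cell y (ipos c)) (map read (work c)) = {}"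
  using assms by (auto simp: matching_def applicable_def halted_def)

text \<open>
  One move of the virtual head from \<open>p\<close> to \<open>p'\<close>, including the update of the counter.
\<close>

lemma count_virtual_move:
  assumes p: "p \<le> m + i + 2" and "m \<le> length x" and "basic (Sim q i e 0)" and "valid_tapes s ws"
    and digits: "\<And>c. c \<le> length x + 1 \<Longrightarrow> length (digits c) + 1 < s"
    and p': "p' = min (m + i + 2) (shift d p)"
    and count: "count x s (Sim q i e (p' - (m + 1))) (min p' (m + 1))
      ((1, counter_tape (m + 1 - p')) # ws) n"
    and vm: "vm = virtual_move d (input_cell x (min p (m + 1))) (counter_tape (m + 1 - p) 1) i
      (p - (m + 1)) q e"
  shows "count x s (fst vm) (min (length x + 1) (shift (snd vm) (min p (m + 1))))
    ((1, counter_tape (m + 1 - p)) # ws) n"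
proof (cases d)
  case Stay
  then have "p' = p" using p p' by simp
  moreover have "min (length x + 1) (min p (m + 1)) = min p (m + 1)"
    using \<open>m \<le> length x\<close> by simp
  ultimately show ?thesis using count Stay vm by simp
next
  case Go_Right
  show ?thesis
  proof (cases "m + 1 \<le> p")
    case True
    then have "p' - (m + 1) = min (p - (m + 1) + 1) (i + 1)" "min p' (m + 1) = m + 1"
        "m + 1 - p' = 0" "min p (m + 1) = m + 1" "m + 1 - p = 0"
      using p p' Go_Right by auto
    moreover have "counter_tape (m + 1 - p) 1 = 0" using True counter_tape_1 by simp
    ultimately show ?thesis using count Go_Right vm \<open>m \<le> length x\<close> by simp
  next
    case False
    then have *: "p' - (m + 1) = 0" "min p' (m + 1) = p + 1" "m + 1 - p = Suc (m + 1 - p')"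
        "min p (m + 1) = p"
      using p p' Go_Right by auto
    have "counter_tape (m + 1 - p) 1 \<noteq> 0" using False counter_tape_1[of "m + 1 - p"] by simp
    then have vm: "vm = (Dec (Sim q i e 0), Go_Right)" using vm Go_Right by simp
    have "count x s (Dec (Sim q i e 0)) (p + 1) ((1, counter_tape (m + 1 - p)) # ws) n"
      unfolding *(3)
    proof (rule count_Dec_counter)
      show "length (digits (Suc (m + 1 - p'))) + 1 < s"
        using digits[of "Suc (m + 1 - p')"] *(3) \<open>m \<le> length x\<close> by simp
      show "count x s (Sim q i e 0) (p + 1) ((1, counter_tape (m + 1 - p')) # ws) n"
        using count by (simp only: *)
    qed (use assms(3,4) False \<open>m \<le> length x\<close> in auto)
    moreover have "min (length x + 1) (shift Go_Right p) = p + 1"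
      using False \<open>m \<le> length x\<close> by simp
    ultimately show ?thesis by (simp only: vm fst_conv snd_conv *(4))
  qed
next
  case Go_Left
  show ?thesis
  proof (cases "m + 1 < p")
    case True
    then have "p' - (m + 1) = p - (m + 1) - 1" "min p' (m + 1) = m + 1"
        "m + 1 - p' = 0" "min p (m + 1) = m + 1" "m + 1 - p = 0" "p - (m + 1) > 0"
      using p p' Go_Left by auto
    then show ?thesis using count Go_Left vm \<open>m \<le> length x\<close> by simp
  next
    case False
    note p_le = False
    show ?thesis
    proof (cases "p = 0")
      case True
      then have "vm = (Sim q i e 0, Stay)" "p' = 0"
        using vm p' Go_Left by (auto simp: input_cell_def)
      then show ?thesis using count True by simp
    next
      case False
      then have *: "p' - (m + 1) = 0" "min p' (m + 1) = p - 1" "m + 1 - p' = Suc (m + 1 - p)"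
          "min p (m + 1) = p" "p - (m + 1) = 0"
        using p p' p_le Go_Left by auto
      have "input_cell x p \<noteq> Left_End" using False by (simp add: input_cell_def)
      then have vm: "vm = (Inc (Sim q i e 0), Go_Left)" using vm Go_Left p_le *(4) by simp
      have "count x s (Inc (Sim q i e 0)) (p - 1) ((1, counter_tape (m + 1 - p)) # ws) n"
      proof (rule count_Inc_counter)
        show "length (digits (Suc (m + 1 - p))) + 1 < s"
          using digits[of "Suc (m + 1 - p)"] *(3) \<open>m \<le> length x\<close> by simp
        show "count x s (Sim q i e 0) (p - 1) ((1, counter_tape (Suc (m + 1 - p))) # ws) n"
          using count by (simp only: *)
      qed (use assms(3,4) p_le \<open>m \<le> length x\<close> in auto)
      moreover have "min (length x + 1) (shift Go_Left p) = p - 1"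
        using p_le \<open>m \<le> length x\<close> by simp
      ultimately show ?thesis by (simp only: vm fst_conv snd_conv *(4))
    qed
  qed
qed

text \<open>
  If \<open>n\<close> paths accept after the simulation, then the number of accepting paths during the
  simulation is \<open>n\<close> times the number of ways to complete the guess.
\<close>

lemma count_Sim:
  assumes i: "i \<le> C" and m: "m \<le> length x" and S: "S < s"
    and digits: "\<And>c. c \<le> length x + 1 \<Longrightarrow> length (digits c) + 1 < s"
    and Rewind: "\<And>h c ws us. h + c = m + 1 \<Longrightarrow> length us = tapes M \<Longrightarrow>
      list_all2 (simulates S) ws us \<Longrightarrow>
      count x s (Rewind i) h ((1, counter_tape c) # ws) n"
    and "run M (argument m i) c is c'" "halted M (argument m i) c'"
    and "\<And>js d. run M (argument m i) c js d \<Longrightarrow> \<forall>(p, t)\<in>set (work d). p < S"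
    and "list_all2 (simulates S) ws (work c)" "length (work c) = tapes M"
    and "ipos c \<le> m + i + 2" "state c \<in> insert (start M) (nxt ` instrs M)" "e \<le> 2"
  shows "count x s (Sim (state c) i e (ipos c - (m + 1))) (min (ipos c) (m + 1))
    ((1, counter_tape (m + 1 - ipos c)) # ws) (weight e (List.map_filter out is) * n)"
  using assms(6-)
proof (induction "is" arbitrary: c e ws)
  case Nil
  let ?y = "argument m i" and ?h = "min (ipos c) (m + 1)" and ?c = "m + 1 - ipos c"
    and ?v = "ipos c - (m + 1)"
  have halted: "halted M ?y c" using Nil.prems by simp
  have valid: "valid_tapes s ws"
    using Nil.prems S by (intro simulates_valid)
  have "1 < s" using digits[of 0] by simp
  have basic: "basic (Sim (state c) i e ?v)" using Nil.prems i by auto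
  have delta: "delta (Sim (state c) i e ?v) (input_cell x ?h) (counter_tape ?c 1 # map read ws) =
      (if e = 0 then {} else {(Rewind i, Stay, keep (counter_tape ?c 1 # map read ws))})"
    using matching_halted[OF halted] simulates_read[OF Nil.prems(4)] virtual_symbol[OF Nil.prems(6)]
    by simp
  show ?case
  proof (cases "e = 0")
    case True
    have "count x s (Sim (state c) i e ?v) ?h ((1, counter_tape ?c) # ws)
        (of_bool (Sim (state c) i e ?v \<in> range Accept))"
      using delta True valid \<open>1 < s\<close> phases_intros(1)[OF basic]
      by (intro count_halt) (simp_all add: valid_counter[simplified])
    moreover have "of_bool (Sim (state c) i e ?v \<in> range Accept) = weight e [] * n"
      using True by (auto simp: weight_def binary_value_Nil)
    ultimately show ?thesis by (simp add: map_filter_simps)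
  next
    case False
    have "?h + ?c = m + 1" by simp
    from Rewind[OF this Nil.prems(5,4)]
    have "count x s (Rewind i) (min (length x + 1) (shift Stay ?h)) ((1, counter_tape ?c) # ws) n"
      using m by (simp add: min.absorb2 min.coboundedI2)
    then have "count x s (Sim (state c) i e ?v) ?h ((1, counter_tape ?c) # ws) n"
      using False delta basic valid \<open>1 < s\<close>
      by - (rule count_keep_step[where q' = "Rewind i" and d = Stay], simp_all only: if_False)
    then show ?thesis using False by (simp add: weight_def map_filter_simps)
  qed
next
  case (Cons I "is")
  let ?y = "argument m i" and ?h = "min (ipos c) (m + 1)" and ?c = "m + 1 - ipos c"
    and ?v = "ipos c - (m + 1)"
  let ?as = "map2 (\<lambda>r (b, d). (mark r b, d)) (map read ws) (acts I)"
  let ?vm = "virtual_move (imove I) (input_cell x ?h) (counter_tape ?c 1) i ?v (nxt I)"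
  let ?ws = "map2 act ?as ws"
  have app: "applicable M ?y c I" and run: "run M ?y (exec ?y I c) is c'"
    using Cons.prems by auto
  have I: "I \<in> instrs M" using app by (simp add: applicable_def)
  have "1 < s" using digits[of 0] by simp
  have valid: "valid_tapes s ws"
    using Cons.prems S by (intro simulates_valid)
  have basic: "basic (Sim (state c) i e ?v)" using Cons.prems i by auto
  have delta: "delta (Sim (state c) i e ?v) (input_cell x ?h) (map read ((1, counter_tape ?c) # ws)) =
      (\<lambda>e'. (fst (?vm e'), snd (?vm e'), (counter_tape ?c 1, Stay) # ?as)) ` guesses (out I) e"
    using matching_applicable[OF app] simulates_read[OF Cons.prems(4)] virtual_symbol[OF Cons.prems(6)]
    by simp
  have "run M ?y c [] c" by simp
  from Cons.prems(3)[OF this] have space: "\<forall>(p, t)\<in>set (work c). p < S" .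
  have sim: "list_all2 (simulates S) ?ws (work (exec ?y I c))"
    using simulates_exec[OF Cons.prems(4,5) I space] by (simp add: exec_def)
  have len: "length (work (exec ?y I c)) = tapes M"
    using Cons.prems(5) I wf by (simp add: exec_def wf_machine_def)
  have valid': "valid_tapes s ?ws" using sim len S by (intro simulates_valid)
  have IH: "count x s (Sim (nxt I) i e' (ipos (exec ?y I c) - (m + 1))) (min (ipos (exec ?y I c)) (m + 1))
      ((1, counter_tape (m + 1 - ipos (exec ?y I c))) # ?ws) (weight e' (List.map_filter out is) * n)"
    if "e' \<in> guesses (out I) e" for e'
  proof -
    have "state (exec ?y I c) = nxt I" by (simp add: exec_def)
    moreover have "count x s (Sim (state (exec ?y I c)) i e' (ipos (exec ?y I c) - (m + 1)))
        (min (ipos (exec ?y I c)) (m + 1))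
        ((1, counter_tape (m + 1 - ipos (exec ?y I c))) # ?ws) (weight e' (List.map_filter out is) * n)"
    proof (rule Cons.IH[OF run Cons.prems(2) _ sim len])
      fix js d assume "run M ?y (exec ?y I c) js d"
      then have "run M ?y c (I # js) d" using app by simp
      then show "\<forall>(p, t)\<in>set (work d). p < S" by (rule Cons.prems(3))
    next
      show "ipos (exec ?y I c) \<le> m + i + 2" by (simp add: exec_def length_argument)
      show "state (exec ?y I c) \<in> insert (start M) (nxt ` instrs M)"
        using I by (simp add: exec_def)
      show "e' \<le> 2" using guesses_le[OF that Cons.prems(8)] .
    qed
    ultimately show ?thesis by simp
  qed
  have "count x s (fst (?vm e')) (min (length x + 1) (shift (snd (?vm e')) ?h))
      (map2 act ((counter_tape ?c 1, Stay) # ?as) ((1, counter_tape ?c) # ws))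
      (weight e' (List.map_filter out is) * n)"
    if e': "e' \<in> guesses (out I) e" for e'
  proof -
    have "count x s (fst (?vm e')) (min (length x + 1) (shift (snd (?vm e')) ?h))
        ((1, counter_tape ?c) # ?ws) (weight e' (List.map_filter out is) * n)"
    proof (rule count_virtual_move[OF Cons.prems(6) m _ valid' digits _ IH[OF e'] refl])
      show "basic (Sim (nxt I) i e' 0)"
        using I i guesses_le[OF e' Cons.prems(8)] by simp
      show "ipos (exec ?y I c) = min (m + i + 2) (shift (imove I) (ipos c))"
        by (simp add: exec_def length_argument)
    qed
    moreover have "map2 act ((counter_tape ?c 1, Stay) # ?as) ((1, counter_tape ?c) # ws) =
        (1, counter_tape ?c) # ?ws"
      by simp
    ultimately show ?thesis by (simp only:)
  qed
  note step = this
  show ?case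
  proof (rule count_branch[OF delta finite_guesses guesses_nonempty inj_virtual_move
        phases_intros(1)[OF basic] _ step])
    show "valid s ((1, counter_tape ?c) # ws)" using valid \<open>1 < s\<close> by (simp only: valid_counter)
    have "(\<Sum>e'\<in>guesses (out I) e. weight e' (List.map_filter out is) * n) =
        weight e (List.map_filter out (I # is)) * n"
      unfolding sum_distrib_right[symmetric] sum_guesses
      by (cases "out I") (simp_all add: map_filter_simps)
    then show "weight e (List.map_filter out (I # is)) * n =
        (\<Sum>e'\<in>guesses (out I) e. weight e' (List.map_filter out is) * n)" by simp
  qed
qed

end

section \<open>Counting along the recurrence\<close>

lemma extend0_apply: "inj_on enc I \<Longrightarrow> i \<in> I \<Longrightarrow> extend0 enc I g (enc i) = g i"
  by (simp add: extend0_def)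

lemma extend0_ones:
  "extend0 ones {1..} g x = (if x = ones (length x) \<and> x \<noteq> [] then g (length x) else 0)"
proof (cases "x \<in> ones ` {1..}")
  case True
  then obtain n where "1 \<le> n" "x = ones n" by auto
  moreover have "inj_on ones {1..}"
    by (rule inj_on_inverseI[of _ length]) (simp add: ones_def)
  ultimately show ?thesis
    using extend0_apply[of ones "{1..}" n g] by (auto simp: ones_def)
next
  case False
  then have "\<not> (x = ones (length x) \<and> x \<noteq> [])" by (cases x) force+
  then show ?thesis using False by (auto simp: extend0_def)
qed

context recurrence_machine
begin

text \<open>
  After a simulation the machine proceeds from \<open>m = h + c - 1\<close> to \<open>m - i\<close>.
\<close>

lemma count_clear:
  assumes "list_all2 (simulates S) ws us" "length us = tapes M" "S < s"
    and digits: "\<And>c. c \<le> length x + 1 \<Longrightarrow> length (digits c) + 1 < s"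
    and "i \<le> C" "h + c \<le> length x + 1"
    and walk: "count x s (Walk 0) (h + c - i) ((1, counter_tape 0) # fresh_tapes) n"
  shows "count x s (Rewind i) h ((1, counter_tape c) # ws) n"
proof -
  have s: "1 < s" using digits[of 0] by simp
  have valid: "valid_tapes s fresh_tapes" using s by (intro valid_fresh_tapes) simp
  have "count x s (Back i) (h + c) ((1, counter_tape 0) # fresh_tapes) n"
    using count_Back[OF valid s assms(5,6) walk] .
  then have Advance: "count x s (Advance i) h ((1, counter_tape c) # fresh_tapes) n"
    using count_Advance[OF valid digits assms(5,6)] by blast
  have Erase: "count x s (Erase i) h ((1, counter_tape c) # ws') n"
    if "length ws' = tapes M" "\<forall>(p, t)\<in>set ws'. p \<le> S \<and> shape p t" for ws'
    using that by (intro count_Erase[OF \<open>i \<le> C\<close> s \<open>S < s\<close> _ _ _ Advance, of _ S])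
      (use assms(6) in auto)
  have tapes: "\<exists>l\<le>S. shape l t \<and> p \<le> l \<and> l \<le> p + S" if "(p, t) \<in> set ws" for p t
  proof -
    obtain u where "simulates S (p, t) u"
      using assms(1) \<open>(p, t) \<in> set ws\<close> by (metis in_set_conv_nth list_all2_nthD)
    then show ?thesis by (cases u) (auto intro: trans_le_add2)
  qed
  show ?thesis
  proof (rule count_Rewind[OF \<open>i \<le> C\<close> s \<open>S < s\<close> _ _ _ Erase])
    show "length ws = tapes M" using list_all2_lengthD[OF assms(1)] assms(2) by simp
    show "\<forall>(p, t)\<in>set ws. \<exists>l\<le>S. shape l t \<and> p \<le> l \<and> l \<le> p + S" using tapes by blast
    show "h \<le> length x + 1" using assms(6) by simp
  qed
qed

lemma simulates_init: "1 \<le> S \<Longrightarrow> list_all2 (simulates S) fresh_tapes (work (init M))"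
  using shape_fresh
  by (auto simp: fresh_tapes_def init_def list_all2_conv_all_nth plain_def tape_of_def)

text \<open>
  By strong induction on \<open>m\<close>: the guessed \<open>i\<close> contributes \<open>D m i * A (m - i)\<close> paths, the first
  factor by the simulation and the second one by the induction hypothesis.
\<close>

lemma count_recurrence:
  assumes D: "\<And>m i. C < m \<Longrightarrow> i \<in> {1..C} \<Longrightarrow> \<exists>is c. run M (argument m i) (init M) is c \<and>
      halted M (argument m i) c \<and> D m i = binary_value (List.map_filter out is)"
    and A: "\<And>m. C < m \<Longrightarrow> A m = (\<Sum>i=1..C. D m i * A (m - i))"
    and C: "1 \<le> C"
    and space: "\<And>m i is d. m \<le> length x \<Longrightarrow> i \<le> C \<Longrightarrow>
      run M (argument m i) (init M) is d \<Longrightarrow> \<forall>(p, t)\<in>set (work d). p < S"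
    and S: "1 \<le> S" "S < s"
    and digits: "\<And>c. c \<le> length x + 1 \<Longrightarrow> length (digits c) + 1 < s"
    and "m \<le> length x"
  shows "count x s (Walk 0) (m + 1) ((1, counter_tape 0) # fresh_tapes) (A m)"
  using \<open>m \<le> length x\<close>
proof (induction m rule: less_induct)
  case (less m)
  have s: "1 < s" using digits[of 0] by simp
  have valid: "valid_tapes s fresh_tapes" using s by (intro valid_fresh_tapes) simp
  let ?ws = "(1, counter_tape (m + 1)) # fresh_tapes"
  let ?j = "min (C + 2) (m + 1)"
  have Left_End: "input_cell x 0 = Left_End" by (simp add: input_cell_def)
  have min_0: "min (length x + 1) (shift Stay 0) = 0" by simp
  have keep: "map2 act (keep (map read ?ws)) ?ws = ?ws" by (rule map2_act_keep)
  have read: "map read ?ws = counter_tape (m + 1) 1 # map read fresh_tapes" by simp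
  have valid': "valid s ?ws" using valid s by (simp only: valid_counter)
  have Walk: "Walk ?j \<in> phases" by (intro phases_intros) simp
  have "count x s (Walk ?j) 0 ?ws (A m)"
  proof (cases "m \<le> C")
    case True
    have delta: "delta (Walk ?j) (input_cell x 0) (map read ?ws) =
        (\<lambda>b. (Accept b, Stay, keep (map read ?ws))) ` {..<A m}"
      unfolding Left_End read delta.simps using True by simp
    show ?thesis
    proof (cases "A m = 0")
      case True
      then have "count x s (Walk ?j) 0 ?ws (of_bool (Walk ?j \<in> range Accept))"
        using delta by (intro count_halt Walk valid') simp
      moreover have "of_bool (Walk ?j \<in> range Accept) = A m" using True by auto
      ultimately show ?thesis by simp
    next
      case False
      have "count x s (Accept b) 0 ?ws 1" if "b < A m" for b
      proof -
        have "Accept b \<in> phases" using that \<open>m \<le> C\<close> by (intro phases_intros) auto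
        then have "count x s (Accept b) 0 ?ws (of_bool (Accept b \<in> range Accept))"
          by (intro count_halt valid') simp
        then show ?thesis by simp
      qed
      then have "count x s (Accept b) (min (length x + 1) (shift Stay 0))
          (map2 act (keep (map read ?ws)) ?ws) 1" if "b \<in> {..<A m}" for b
        unfolding min_0 keep using that by blast
      then show ?thesis
        using False
        by (intro count_branch[OF delta _ _ _ Walk valid', where f = "\<lambda>_. 1"])
          (auto simp only: inj_on_def phase.inject finite_lessThan sum_constant card_lessThan
            lessThan_empty_iff bot_nat_def mult_1_right of_nat_id)
    qed
  next
    case False
    have delta: "delta (Walk ?j) (input_cell x 0) (map read ?ws) =
        (\<lambda>i. (Sim (start M) i 0 0, Stay, keep (map read ?ws))) ` {1..C}"
      unfolding Left_End read delta.simps using False by simp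
    have Sim: "count x s (Sim (start M) i 0 0) 0 ?ws (D m i * A (m - i))" if i: "i \<in> {1..C}" for i
    proof -
      obtain "is" c where run: "run M (argument m i) (init M) is c" "halted M (argument m i) c"
        and D: "D m i = binary_value (List.map_filter out is)"
        using D[of m i] False i by auto
      have "count x s (Sim (state (init M)) i 0 (ipos (init M) - (m + 1))) (min (ipos (init M)) (m + 1))
          ((1, counter_tape (m + 1 - ipos (init M))) # fresh_tapes)
          (weight 0 (List.map_filter out is) * A (m - i))"
      proof (rule count_Sim[OF _ less.prems S(2) digits _ run])
        fix h c ws us
        assume hc: "h + c = m + 1" "length us = tapes M" "list_all2 (simulates S) ws us"
        have "count x s (Walk 0) (m - i + 1) ((1, counter_tape 0) # fresh_tapes) (A (m - i))"
          using i less.prems False by (intro less.IH) auto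
        moreover have "m - i + 1 = h + c - i" using hc i False by auto
        ultimately show "count x s (Rewind i) h ((1, counter_tape c) # ws) (A (m - i))"
          using hc i less.prems by (intro count_clear[OF hc(3,2) S(2) digits]) auto
      next
        fix js d assume "run M (argument m i) (init M) js d"
        then show "\<forall>(p, t)\<in>set (work d). p < S" using i less.prems by (intro space) auto
      next
        show "list_all2 (simulates S) fresh_tapes (work (init M))" using S(1) by (rule simulates_init)
      qed (use i in \<open>auto simp: init_def\<close>)
      then show ?thesis by (simp add: init_def weight_def D)
    qed
    show ?thesis
    proof (rule count_branch[OF delta _ _ _ Walk valid'])
      show "count x s (Sim (start M) j 0 0) (min (length x + 1) (shift Stay 0))
          (map2 act (keep (map read ?ws)) ?ws) (D m j * A (m - j))" if "j \<in> {1..C}" for j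
        unfolding min_0 keep using Sim[OF that] .
      show "A m = (\<Sum>i=1..C. D m i * A (m - i))" using A False by simp
    qed (use C in \<open>auto simp: inj_on_def\<close>)
  qed
  then have "count x s (Walk (min (C + 2) (0 + (m + 1)))) 0
      ((1, counter_tape (0 + (m + 1))) # fresh_tapes) (A m)"
    by simp
  from count_Walk[OF valid digits _ this] less.prems show ?case by simp
qed

text \<open>
  The first \<open>h - 1\<close> input symbols have been found to be \<open>1\<close>.  A symbol \<open>0\<close> makes the machine
  reject.
\<close>

lemma count_Scan:
  assumes s: "1 < s" and A0: "A 0 = 0"
    and Walk: "\<And>m. m \<le> length x \<Longrightarrow>
      count x s (Walk 0) (m + 1) ((1, counter_tape 0) # fresh_tapes) (A m)"
    and "1 \<le> h" "h \<le> length x + 1" "take (h - 1) x = ones (h - 1)"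
  shows "count x s Scan h ((1, counter_tape 0) # fresh_tapes) (extend0 ones {1..} A x)"
  using assms(4-)
proof (induction "length x + 1 - h" arbitrary: h)
  case 0
  then have h: "h = length x + 1" and x: "x = ones (length x)" by auto
  then have val: "extend0 ones {1..} A x = A (length x)"
    unfolding extend0_ones using A0 by auto
  have "input_cell x h = Right_End" using h by (simp add: input_cell_def)
  moreover have "count x s (Walk 0) (min (length x + 1) (shift Stay h))
      ((1, counter_tape 0) # fresh_tapes) (A (length x))"
    using Walk[of "length x"] h by simp
  ultimately show ?case
    unfolding val using s valid_fresh_tapes[of s]
    by - (rule count_keep_step[where q' = "Walk 0" and d = Stay], simp_all)
next
  case (Suc k)
  then have h: "h - 1 < length x" "h = Suc (h - 1)" by auto
  have cell: "input_cell x h = Sym (x ! (h - 1))" using h by (simp add: input_cell_def)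
  show ?case
  proof (cases "x ! (h - 1)")
    case True
    have "take (Suc (h - 1)) x = ones (Suc (h - 1))"
      using Suc.prems(3) True h(1)
      by (simp add: take_Suc_conv_app_nth ones_def replicate_append_same)
    then have "count x s Scan (h + 1) ((1, counter_tape 0) # fresh_tapes) (extend0 ones {1..} A x)"
      using Suc h by (intro Suc.hyps(1)) auto
    then have "count x s Scan (min (length x + 1) (shift Go_Right h))
        ((1, counter_tape 0) # fresh_tapes) (extend0 ones {1..} A x)"
      using h by simp
    then show ?thesis
      using s valid_fresh_tapes[of s] cell True
      by - (rule count_keep_step[where q' = Scan and d = Go_Right], simp_all)
  next
    case False
    then have "x \<notin> range ones" using h(1) by (auto simp: ones_def)
    then have val: "extend0 ones {1..} A x = of_bool (Scan \<in> range Accept)"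
      by (auto simp: extend0_def)
    have "valid s ((1, counter_tape 0) # fresh_tapes)"
      using s valid_fresh_tapes[of s] by (simp only: valid_counter)
    then show ?thesis
      unfolding val using cell False
      by (intro count_halt phases_intros) simp_all
  qed
qed

lemma count_Init:
  assumes s: "1 < s" and A0: "A 0 = 0"
    and Walk: "\<And>m. m \<le> length x \<Longrightarrow>
      count x s (Walk 0) (m + 1) ((1, counter_tape 0) # fresh_tapes) (A m)"
  shows "path_count mach x s (init mach) (extend0 ones {1..} A x)"
proof -
  let ?ws = "replicate (tapes M) (0, \<lambda>_. 0)"
  have init: "init mach = cfg Init 0 ((0, \<lambda>_. 0) # ?ws)"
    by (simp add: init_def mach_def cfg_def)
  have "(\<lambda>_. 0)(0 := 3) = counter_tape 0"
    by (auto simp: counter_tape_def tape_of_def)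
  moreover have "(\<lambda>_. 0)(0 := 2) = tape_of [2]"
    by (auto simp: tape_of_def)
  ultimately have ws: "map2 act ((3, Go_Right) # map (\<lambda>_. (2, Stay)) (map read ?ws))
      ((0, \<lambda>_. 0) # ?ws) = (1, counter_tape 0) # fresh_tapes"
    by (simp add: fresh_tapes_def map_replicate_const zip_replicate)
  have "count x s Init 0 ((0, \<lambda>_. 0) # ?ws) (extend0 ones {1..} A x)"
  proof (rule count_det)
    show "delta Init (input_cell x 0) (map read ((0, \<lambda>_. 0) # ?ws)) =
        {(Scan, Go_Right, (3, Go_Right) # map (\<lambda>_. (2, Stay)) (map read ?ws))}"
      by simp
    show "Init \<in> phases" by (intro phases_intros) simp
    show "valid s ((0, \<lambda>_. 0) # ?ws)"
      using s alphabet_bound_gt by (simp add: valid_def)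
    show "count x s Scan (min (length x + 1) (shift Go_Right 0))
        (map2 act ((3, Go_Right) # map (\<lambda>_. (2, Stay)) (map read ?ws)) ((0, \<lambda>_. 0) # ?ws))
        (extend0 ones {1..} A x)"
      unfolding ws using count_Scan[OF s A0 Walk, of 1] by (simp add: ones_def)
  qed
  then show ?thesis by (simp add: init count_def)
qed

end

section \<open>The space bound\<close>

text \<open>
  The maximum accounts for the simulated inputs, whose length exceeds that of the real input by
  at most a constant \<open>k\<close>; the logarithm accounts for the counter.
\<close>

lemma log_space_bound:
  fixes f :: "nat \<Rightarrow> nat"
  assumes "(\<lambda>n. real (f n)) \<in> O(\<lambda>n. ln (real n))"
  shows "(\<lambda>n. real (Max (insert 1 (f ` {..n + k})) + nat \<lfloor>log 2 (real n + 2)\<rfloor> + 3))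
    \<in> O(\<lambda>n. ln (real n))"
proof -
  obtain c where "\<forall>\<^sub>F n in at_top. norm (real (f n)) \<le> c * norm (ln (real n))"
    using assms by (elim landau_o.bigE)
  then obtain N where N: "\<And>n. n \<ge> N \<Longrightarrow> real (f n) \<le> c * \<bar>ln (real n)\<bar>"
    by (auto simp: eventually_at_top_linorder)
  define b where "b = Max (insert 1 (f ` {..N}))"
  define g where "g n = real b + \<bar>c\<bar> * ln (real n + real k + 1) + log 2 (real n + 2) + 3" for n
  have f: "real (f j) \<le> real b + \<bar>c\<bar> * ln (real n + real k + 1)" if "j \<le> n + k" for j n
  proof (cases "j \<le> N")
    case True
    then have "f j \<le> b" unfolding b_def by (intro Max_ge) auto
    moreover have "0 \<le> \<bar>c\<bar> * ln (real n + real k + 1)" by simp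
    ultimately show ?thesis by linarith
  next
    case False
    then have "real (f j) \<le> c * \<bar>ln (real j)\<bar>" by (intro N) simp
    also have "\<dots> \<le> \<bar>c\<bar> * ln (real n + real k + 1)"
      using False that by (intro mult_mono) auto
    finally show ?thesis by simp
  qed
  have max: "real (Max (insert 1 (f ` {..n + k}))) \<le> real b + \<bar>c\<bar> * ln (real n + real k + 1)" for n
  proof -
    have "1 \<le> b" unfolding b_def by (intro Max_ge) auto
    moreover have "0 \<le> \<bar>c\<bar> * ln (real n + real k + 1)" by simp
    ultimately have "real 1 \<le> real b + \<bar>c\<bar> * ln (real n + real k + 1)" by linarith
    moreover have "Max (insert 1 (f ` {..n + k})) \<in> insert 1 (f ` {..n + k})"
      by (intro Max_in) auto
    ultimately show ?thesis using f[of _ n] by (metis atMost_iff image_iff insert_iff)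
  qed
  have log: "real (nat \<lfloor>log 2 (real n + 2)\<rfloor>) \<le> log 2 (real n + 2)" for n
  proof -
    have "0 \<le> log 2 (real n + 2)" by (simp add: zero_le_log_cancel_iff)
    then show ?thesis by (rule of_nat_floor)
  qed
  have "norm (real (Max (insert 1 (f ` {..n + k})) + nat \<lfloor>log 2 (real n + 2)\<rfloor> + 3)) \<le> norm (g n)" for n
  proof -
    have "real (Max (insert 1 (f ` {..n + k})) + nat \<lfloor>log 2 (real n + 2)\<rfloor> + 3) \<le> g n"
      unfolding g_def of_nat_add of_nat_numeral using max[of n] log[of n] by linarith
    then show ?thesis unfolding real_norm_def by linarith
  qed
  then have "(\<lambda>n. real (Max (insert 1 (f ` {..n + k})) + nat \<lfloor>log 2 (real n + 2)\<rfloor> + 3)) \<in> O(g)"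
    by (intro landau_o.big_mono always_eventually) blast
  also have "g \<in> O(\<lambda>n. ln (real n))"
    unfolding g_def by real_asymp
  finally show ?thesis .
qed

section \<open>Linear recurrences\<close>

lemma inj_argument: "inj (\<lambda>(m, i). argument m i)"
proof (rule injI, clarify)
  fix m i m' i' assume eq: "argument m i = argument m' i'"
  have "length (takeWhile id (argument m i)) = m" for m i
    by (simp add: argument_def ones_def takeWhile_append)
  then have "m = m'" using eq by metis
  then show "m = m' \<and> i = i'" using arg_cong[OF eq, of length] by (simp add: length_argument)
qed

theorem theorem3p7:
  fixes C :: nat and A :: "nat \<Rightarrow> nat" and D :: "nat \<Rightarrow> nat \<Rightarrow> nat"
  assumes "C \<ge> 1"
    and "\<And>n. n > C \<Longrightarrow> A n = (\<Sum>i=1..C. D n i * A (n - i))"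
    and "\<exists>p :: real poly. \<forall>n>C. \<forall>i\<in>{1..C}. real (D n i) \<le> poly p (real n)"
    and "extend0 (\<lambda>(n, i). ones n @ [False] @ ones i) {(n, i). n > C \<and> i \<in> {1..C}}
           (\<lambda>(n, i). D n i) \<in> FL_nonneg"
  shows "extend0 ones {1..} A \<in> sharpL"
proof -
  let ?I = "{(n, i). n > C \<and> i \<in> {1..C}}"
  obtain M :: "bool option machine" where M: "wf_machine M" "deterministic M" "log_space M"
    and out: "\<And>x. \<exists>is c. run M x (init M) is c \<and> halted M x c \<and>
      extend0 (\<lambda>(n, i). argument n i) ?I (\<lambda>(n, i). D n i) x = binary_value (List.map_filter out is)"
    using assms(4) unfolding FL_nonneg_def argument_def by blast
  have D: "\<exists>is c. run M (argument m i) (init M) is c \<and> halted M (argument m i) c \<and>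
      D m i = binary_value (List.map_filter out is)" if "C < m" "i \<in> {1..C}" for m i
  proof -
    have "extend0 (\<lambda>(n, i). argument n i) ?I (\<lambda>(n, i). D n i) (argument m i) = D m i"
      using extend0_apply[OF inj_on_subset[OF inj_argument], of ?I "(m, i)"] that by simp
    then show ?thesis using out[of "argument m i"] by simp
  qed
  obtain f where f: "(\<lambda>n. real (f n)) \<in> O(\<lambda>n. ln (real n))"
    and space: "\<And>x is c. run M x (init M) is c \<Longrightarrow> \<forall>(p, t)\<in>set (work c). p < f (length x)"
    using M(3) unfolding log_space_def by blast
  \<comment> \<open>The empty input is treated as \<open>1\<^sup>0\<close> and must get the value \<open>0\<close>.
      As \<open>m - i > 0\<close> for \<open>m > C \<ge> i\<close>, the recurrence does not involve \<open>A 0\<close>.\<close>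
  define A' where "A' = A(0 := 0)"
  interpret recurrence_machine M C A' by unfold_locales (fact M)+
  have A': "A' m = (\<Sum>i=1..C. D m i * A' (m - i))" if "C < m" for m
    using assms(2)[OF that] that by (simp add: A'_def)
  define S where "S n = Max (insert 1 (f ` {..n + (C + 1)}))" for n
  define s where "s n = S n + nat \<lfloor>log 2 (real n + 2)\<rfloor> + 3" for n
  have digits: "length (digits c) + 1 < s n" if "c \<le> n + 1" for c n
  proof -
    have "2 ^ length (digits c) \<le> n + 2" using length_digits[of c] that by linarith
    then have "real (2 ^ length (digits c)) \<le> real (n + 2)" by (rule of_nat_mono)
    then have "real (length (digits c)) \<le> log 2 (real n + 2)"
      by (simp add: le_log_iff powr_realpow)
    then have "length (digits c) \<le> nat \<lfloor>log 2 (real n + 2)\<rfloor>" by (simp add: le_nat_floor)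
    then show ?thesis by (simp add: s_def)
  qed
  have S: "1 \<le> S n" for n unfolding S_def by (intro Max_ge) auto
  have s: "1 < s n" "S n < s n" for n by (simp_all add: s_def)
  have "path_count mach x (s (length x)) (init mach) (extend0 ones {1..} A' x)" for x
  proof (rule count_Init)
    fix m assume m: "m \<le> length x"
    show "count x (s (length x)) (Walk 0) (m + 1) ((1, counter_tape 0) # fresh_tapes) (A' m)"
    proof (rule count_recurrence[OF D A' assms(1) _ _ _ digits m])
      fix m i "is" d
      assume "m \<le> length x" "i \<le> C" and run: "run M (argument m i) (init M) is d"
      then have "f (length (argument m i)) \<le> S (length x)"
        unfolding S_def by (intro Max_ge) (auto simp: length_argument)
      then show "\<forall>(p, t)\<in>set (work d). p < S (length x)"
        using space[OF run] by fastforce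
    qed (use S s in auto)
  qed (use s in \<open>simp_all add: A'_def\<close>)
  moreover have "extend0 ones {1..} A' = extend0 ones {1..} A"
    unfolding extend0_ones A'_def by (auto simp: fun_eq_iff)
  moreover have "(\<lambda>n. real (s n)) \<in> O(\<lambda>n. ln (real n))"
    unfolding s_def S_def by (rule log_space_bound[OF f])
  ultimately show ?thesis
    using sharpL_intro[OF wf_mach] by metis
qed

end
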